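(* Let $K$ be a commutative $\mathbb{Q}$-algebra of coefficients, let $A^{ij}_{mn}\in K$ ($i,j\in\{1,2\}$, $m,n\geq0$) and $A_{mn}\in K$ ($m,n\ge0$) be arbitrary, and let $Q$ be a formal variable. Define the two-component Bogoliubov transform in $\mathcal{F}_1\otimes\mathcal{F}_2$ $$V_1=\exp\Big(\sum_{i,j=1,2}\ \sum_{m,n\geq0}A^{ij}_{mn}\,\psi^i_{m+\frac12}\,\psi^{j*}_{-n-\frac12}\Big)|0_{12}\rangle ,$$ and the formal power series in $Q$ with coefficients in $\mathcal{F}_2$ $$\tilde V_2=\exp\Big(\sum_{m,n\geq0}Q^{m+n+1}A_{mn}\,\psi^2_{m+\frac12}\,\psi^{2*}_{-n-\frac12}\Big)|0_2\rangle .$$ Let $$V_0=\Big(\exp\Big(\sum_{m,n\geq0}A^{22}_{mn}\,\psi^2_{m+\frac12}\,\psi^{2*}_{-n-\frac12}\Big)|0_2\rangle,\ \tilde V_2\Big)\in K[[Q]],$$ where the inner product is taken in $\mathcal{F}_2$, and let $\tilde V=(V_1,\tilde V_2)$, where the inner product is taken on the $\mathcal{F}_2$ component, so that $\tilde V$ is a formal power series in $Q$ with coefficients in $\mathcal{F}_1$. Then $V=\tilde V/V_0$ is a Bogoliubov transform of the fermionic vacuum $|0_1\rangle\in\mathcal{F}_1$: there exist formal power series $R_{mn}\in K[[Q]]$ ($m,n\ge0$) such that $$V=\exp\Big(\sum_{m,n\geq0}R_{mn}\,\psi^1_{m+\frac12}\,\psi^{1*}_{-n-\frac12}\Big)|0_1\rangle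 .$$
   Context: **Fermionic Fock space.** A set $A=\{a_1>a_2>\cdots\}\subset\mathbb{Z}+\frac12$ is admissible if both $A\setminus\{r<0\}$ and $\{r\in\mathbb{Z}+\frac12: r<0\}\setminus A$ are finite. $\mathcal{F}$ is the free $K$-module with basis the symbols $\underline{A}=\underline{a_1}\wedge\underline{a_2}\wedge\cdots$, for $A$ admissible. The charge of $\underline{A}$ is $|A\setminus\{r<0\}|-|\{r\in\mathbb{Z}+\frac12:r<0\}\setminus A|$. The vacuum is $|0\rangle=\underline{-\tfrac12}\wedge\underline{-\tfrac32}\wedge\cdots$. For $r\in\mathbb{Z}+\frac12$: $\psi_r\underline{A}=(-1)^k\,\underline{a_1}\wedge\cdots\wedge\underline{a_k}\wedge\underline{r}\wedge\underline{a_{k+1}}\wedge\cdots$ if $a_k>r>a_{k+1}$ for some $k\ge0$ (with $a_0=+\infty$), and $\psi_r\underline{A}=0$ if $r\in A$; $\psi_r^*\underline{A}=(-1)^{k+1}\,\underline{a_1}\wedge\cdots\wedge\widehat{\underline{a_k}}\wedge\cdots$ if $a_k=r$ for some $k$, and $\psi_r^*\underline{A}=0$ otherwise. These satisfy $\psi_r\psi_s^*+\psi_s^*\psi_r=\delta_{rs}$, all other anticommutators being zero. The inner product on $\mathcal{F}$ is the $K$-bilinear form for which the $\underline{A}$ are orthonormal; $\psi_r$ and $\psi_r^*$ are adjoint to each other. **Two components.** $\mathcal{F}_1,\mathcal{F}_2$ are two copies of $\mathcal{F}$ with vacua $|0_1\rangle,|0_2\rangle$, and $|0_{12}\rangle=|0_1\rangle\otimes|0_2\rangle$.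 The operators $\psi^i_r,\psi^{i*}_r$ act on the $i$-th tensor factor as $\psi_r,\psi_r^*$, with the Koszul sign convention, so that $\psi^i_r,\psi^{i*}_r$ anticommute with $\psi^j_s,\psi^{j*}_s$ for $i\neq j$ (concretely, operators on the second factor acquire the sign $(-1)^{c}$ when acting on $u\otimes v$ with $u$ of charge $c$). **Completions and partial inner product.** The exponentials applied to vacua are infinite formal linear combinations of basis vectors, in which each coefficient is a finite polynomial expression in the given coefficients; such infinite formal combinations are allowed as elements of "$\mathcal{F}_1$", "$\mathcal{F}_2$" and "$\mathcal{F}_1\otimes\mathcal{F}_2$". If $V_1=\sum_{A,B}c_{AB}\,\underline{A}\otimes\underline{B}$ and $\tilde V_2=\sum_B d_B\,\underline{B}$ with $d_B\in K[[Q]]$, the inner product on the $\mathcal{F}_2$ component is $(V_1,\tilde V_2)=\sum_A\big(\sum_B c_{AB}d_B\big)\underline{A}$. It is well defined as a formal power series in $Q$, because only finitely many $B$ contribute to each power of $Q$. $V_0$ has constant term $1$ and so is invertible in $K[[Q]]$. *)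

theory Defs
  imports
    "HOL-Computational_Algebra.Formal_Power_Series"
    "HOL-Library.Groups_Big_Fun"
begin

section \<open>Commutative algebras over the rationals\<close>

class comm_rat_algebra_1 = comm_ring_1 +
  fixes scaleQ :: "rat \<Rightarrow> 'a \<Rightarrow> 'a"
  assumes scaleQ_add_right: "scaleQ a (x + y) = scaleQ a x + scaleQ a y"
    and scaleQ_add_left: "scaleQ (a + b) x = scaleQ a x + scaleQ b x"
    and scaleQ_scaleQ: "scaleQ a (scaleQ b x) = scaleQ (a * b) x"
    and scaleQ_one: "scaleQ 1 x = x"
    and mult_scaleQ_left: "scaleQ a x * y = scaleQ a (x * y)"
begin

lemma scaleQ_zero_right [simp]: "scaleQ a 0 = 0"
  using scaleQ_add_right[of a 0 0] by simp

end

instantiation fps :: (comm_rat_algebra_1) comm_rat_algebra_1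
begin

definition scaleQ_fps :: "rat \<Rightarrow> 'a fps \<Rightarrow> 'a fps" where
  "scaleQ_fps a f = Abs_fps (\<lambda>n. scaleQ a (fps_nth f n))"

instance
proof
  fix a b :: rat and x y :: "'a fps"
  show "scaleQ a (x + y) = scaleQ a x + scaleQ a y"
    by (simp add: scaleQ_fps_def fps_eq_iff scaleQ_add_right)
  show "scaleQ (a + b) x = scaleQ a x + scaleQ b x"
    by (simp add: scaleQ_fps_def fps_eq_iff scaleQ_add_left)
  show "scaleQ a (scaleQ b x) = scaleQ (a * b) x"
    by (simp add: scaleQ_fps_def fps_eq_iff scaleQ_scaleQ)
  show "scaleQ 1 x = x"
    by (simp add: scaleQ_fps_def fps_eq_iff scaleQ_one)
  have sum: "scaleQ a (sum f S) = (\<Sum>i\<in>S. scaleQ a (f i))"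
    for f :: "nat \<Rightarrow> 'a" and S
    by (induction S rule: infinite_finite_induct) (simp_all add: scaleQ_add_right)
  show "scaleQ a x * y = scaleQ a (x * y)"
    by (simp add: scaleQ_fps_def fps_eq_iff fps_mult_nth sum mult_scaleQ_left)
qed

end

section \<open>Fock space\<close>

text \<open>
  Half-integers are encoded by integers: the integer \<open>k\<close> stands for \<open>k + 1/2\<close>.
  Hence \<open>k + 1/2 < 0\<close> iff \<open>k < 0\<close>, the half-integer \<open>m + 1/2\<close> is encoded by \<open>m\<close>, and
  \<open>- n - 1/2\<close> is encoded by \<open>- n - 1\<close>.
\<close>

typedef adm = "{A :: int set. finite (A - {..<0}) \<and> finite ({..<0} - A)}"
  morphisms modes Adm
  by (rule exI[of _ "{..<0}"]) simp

definition vac :: adm where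
  "vac = Adm {..<0}"

definition charge :: "adm \<Rightarrow> int" where
  "charge A = int (card (modes A - {..<0})) - int (card ({..<0} - modes A))"

text \<open>
  A formal, possibly infinite, linear combination of basis vectors indexed by \<open>'b\<close> is the function
  \<open>'b \<Rightarrow> 'k\<close> of its coefficients; \<open>'b = adm\<close> for one component and \<open>'b = adm \<times> adm\<close> for two.
\<close>

definition ket :: "'b \<Rightarrow> 'b \<Rightarrow> 'k::comm_ring_1" where
  "ket A = (\<lambda>B. if B = A then 1 else 0)"

definition psi_ket :: "int \<Rightarrow> adm \<Rightarrow> adm \<Rightarrow> 'k::comm_ring_1" where
  "psi_ket r A =
     (if r \<in> modes A then (\<lambda>_. 0)
      else (\<lambda>B. (- 1) ^ card {a \<in> modes A. r < a} * ket (Adm (insert r (modes A))) B))"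

text \<open>If \<open>r\<close> is the \<open>k\<close>-th largest element of \<open>A\<close>, then \<open>k = card {a \<in> A. r \<le> a}\<close>.\<close>

definition psi_star_ket :: "int \<Rightarrow> adm \<Rightarrow> adm \<Rightarrow> 'k::comm_ring_1" where
  "psi_star_ket r A =
     (if r \<in> modes A
      then (\<lambda>B. (- 1) ^ (card {a \<in> modes A. r \<le> a} + 1) * ket (Adm (modes A - {r})) B)
      else (\<lambda>_. 0))"

text \<open>
  Linear extension, to formal linear combinations, of an operator given by its values \<open>T A\<close> on basis
  vectors. \<^const>\<open>Sum_any\<close> is the sum of a finitely supported family and defaults to \<open>0\<close> on infinite
  support; in every use below the support is finite, as shown in the last section.
\<close>

definition lin_ext :: "('b \<Rightarrow> 'b \<Rightarrow> 'k) \<Rightarrow> ('b \<Rightarrow> 'k) \<Rightarrow> 'b \<Rightarrow> 'k::comm_ring_1" where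
  "lin_ext T v = (\<lambda>B. Sum_any (\<lambda>A. v A * T A B))"

definition psi :: "int \<Rightarrow> (adm \<Rightarrow> 'k) \<Rightarrow> adm \<Rightarrow> 'k::comm_ring_1" where
  "psi r = lin_ext (psi_ket r)"

definition psi_star :: "int \<Rightarrow> (adm \<Rightarrow> 'k) \<Rightarrow> adm \<Rightarrow> 'k::comm_ring_1" where
  "psi_star r = lin_ext (psi_star_ket r)"

section \<open>Two components\<close>

definition on_fst :: "(adm \<Rightarrow> adm \<Rightarrow> 'k) \<Rightarrow> adm \<times> adm \<Rightarrow> adm \<times> adm \<Rightarrow> 'k::comm_ring_1" where
  "on_fst T = (\<lambda>(A, B) (A', B'). T A A' * ket B B')"

text \<open>The Koszul sign is \<open>(-1)^c\<close>, where the charge \<open>c\<close> of the first factor may be negative.\<close>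

definition on_snd :: "(adm \<Rightarrow> adm \<Rightarrow> 'k) \<Rightarrow> adm \<times> adm \<Rightarrow> adm \<times> adm \<Rightarrow> 'k::comm_ring_1" where
  "on_snd T = (\<lambda>(A, B) (A', B'). (if even (charge A) then 1 else - 1) * ket A A' * T B B')"

text \<open>The component index \<open>i\<close> of \<open>psi12\<close> and \<open>psi_star12\<close> ranges over \<open>{1, 2}\<close>.\<close>

definition psi12 :: "nat \<Rightarrow> int \<Rightarrow> (adm \<times> adm \<Rightarrow> 'k) \<Rightarrow> adm \<times> adm \<Rightarrow> 'k::comm_ring_1" where
  "psi12 i r = lin_ext ((if i = 1 then on_fst else on_snd) (psi_ket r))"

definition psi_star12 :: "nat \<Rightarrow> int \<Rightarrow> (adm \<times> adm \<Rightarrow> 'k) \<Rightarrow> adm \<times> adm \<Rightarrow> 'k::comm_ring_1" where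
  "psi_star12 i r = lin_ext ((if i = 1 then on_fst else on_snd) (psi_star_ket r))"

section \<open>Bogoliubov transforms of the vacuum\<close>

definition op_exp :: "(('b \<Rightarrow> 'k) \<Rightarrow> 'b \<Rightarrow> 'k) \<Rightarrow> ('b \<Rightarrow> 'k) \<Rightarrow> 'b \<Rightarrow> 'k::comm_rat_algebra_1" where
  "op_exp X v = (\<lambda>B. Sum_any (\<lambda>k. scaleQ (1 / fact k) ((X ^^ k) v B)))"

definition quad :: "(nat \<Rightarrow> nat \<Rightarrow> 'k) \<Rightarrow> (adm \<Rightarrow> 'k) \<Rightarrow> adm \<Rightarrow> 'k::comm_ring_1" where
  "quad c v = (\<lambda>B. Sum_any (\<lambda>(m, n). c m n * psi (int m) (psi_star (- int n - 1) v) B))"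

definition quad12 ::
  "(nat \<Rightarrow> nat \<Rightarrow> nat \<Rightarrow> nat \<Rightarrow> 'k) \<Rightarrow> (adm \<times> adm \<Rightarrow> 'k) \<Rightarrow> adm \<times> adm \<Rightarrow> 'k::comm_ring_1" where
  "quad12 c v = (\<lambda>B. \<Sum>i\<in>{1, 2}. \<Sum>j\<in>{1, 2}.
     Sum_any (\<lambda>(m, n). c i j m n * psi12 i (int m) (psi_star12 j (- int n - 1) v) B))"

definition bogoliubov :: "(nat \<Rightarrow> nat \<Rightarrow> 'k) \<Rightarrow> adm \<Rightarrow> 'k::comm_rat_algebra_1" where
  "bogoliubov c = op_exp (quad c) (ket vac)"

definition bogoliubov12 ::
  "(nat \<Rightarrow> nat \<Rightarrow> nat \<Rightarrow> nat \<Rightarrow> 'k) \<Rightarrow> adm \<times> adm \<Rightarrow> 'k::comm_rat_algebra_1" where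
  "bogoliubov12 c = op_exp (quad12 c) (ket (vac, vac))"

section \<open>Partial inner product\<close>

text \<open>
  The sum of \<open>v B * w B\<close> over \<open>B\<close> is in general infinite, but each power of \<open>Q\<close> receives finitely
  many contributions, so it is taken coefficient by coefficient. \<^const>\<open>fps_X\<close> plays the role of \<open>Q\<close>.
\<close>

definition inner_fock :: "(adm \<Rightarrow> 'k) \<Rightarrow> (adm \<Rightarrow> 'k fps) \<Rightarrow> 'k::comm_ring_1 fps" where
  "inner_fock v w = Abs_fps (\<lambda>n. Sum_any (\<lambda>B. fps_nth (fps_const (v B) * w B) n))"

definition inner_snd :: "(adm \<times> adm \<Rightarrow> 'k) \<Rightarrow> (adm \<Rightarrow> 'k fps) \<Rightarrow> adm \<Rightarrow> 'k::comm_ring_1 fps" where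
  "inner_snd v w = (\<lambda>A. inner_fock (\<lambda>B. v (A, B)) w)"

section \<open>Well-definedness\<close>

lemma modes_vac [simp]: "modes vac = {..<0}"
  by (simp add: vac_def Adm_inverse)

lemma modes_insert [simp]: "modes (Adm (insert r (modes A))) = insert r (modes A)"
proof -
  have "finite (modes A - {..<0})" "finite ({..<0} - modes A)"
    using modes[of A] by auto
  then have "finite (insert r (modes A) - {..<0})" "finite ({..<0} - insert r (modes A))"
    by (auto intro: finite_subset[of _ "insert r (modes A - {..<0})"]
        finite_subset[of _ "{..<0} - modes A"])
  then show ?thesis by (simp add: Adm_inverse)
qed

lemma modes_remove [simp]: "modes (Adm (modes A - {r})) = modes A - {r}"
proof -
  have "finite (modes A - {..<0})" "finite ({..<0} - modes A)"
    using modes[of A] by auto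
  then have "finite ((modes A - {r}) - {..<0})" "finite ({..<0} - (modes A - {r}))"
    by (auto intro: finite_subset[of _ "insert r ({..<0} - modes A)"]
        finite_subset[of _ "modes A - {..<0}"])
  then show ?thesis by (simp add: Adm_inverse)
qed

lemma psi_ket_nonzeroD:
  assumes "psi_ket r A B \<noteq> 0"
  shows "r \<notin> modes A" "modes B = insert r (modes A)"
  using assms by (auto simp: psi_ket_def ket_def split: if_splits)

lemma psi_star_ket_nonzeroD:
  assumes "psi_star_ket r A B \<noteq> 0"
  shows "r \<in> modes A" "modes B = modes A - {r}"
  using assms by (auto simp: psi_star_ket_def ket_def split: if_splits)

lemma finite_psi_ket: "finite {A. psi_ket r A B \<noteq> (0 :: 'k::comm_ring_1)}"
proof (rule finite_subset)
  show "{A. psi_ket r A B \<noteq> (0 :: 'k)} \<subseteq> {Adm (modes B - {r})}"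
  proof clarify
    fix A assume "psi_ket r A B \<noteq> (0 :: 'k)"
    from psi_ket_nonzeroD[OF this] have "modes B - {r} = modes A" by auto
    then show "A = Adm (modes B - {r})" by (simp add: modes_inverse)
  qed
qed simp

lemma finite_psi_star_ket: "finite {A. psi_star_ket r A B \<noteq> (0 :: 'k::comm_ring_1)}"
proof (rule finite_subset)
  show "{A. psi_star_ket r A B \<noteq> (0 :: 'k)} \<subseteq> {Adm (insert r (modes B))}"
  proof clarify
    fix A assume "psi_star_ket r A B \<noteq> (0 :: 'k)"
    from psi_star_ket_nonzeroD[OF this] have "insert r (modes B) = modes A" by auto
    then show "A = Adm (insert r (modes B))" by (simp add: modes_inverse)
  qed
qed simp

lemma on_fst_nonzeroD:
  assumes "on_fst T (A, B) (A', B') \<noteq> 0"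
  shows "T A A' \<noteq> 0" "B = B'"
  using assms by (auto simp: on_fst_def ket_def split: if_splits)

lemma on_snd_nonzeroD:
  assumes "on_snd T (A, B) (A', B') \<noteq> 0"
  shows "T B B' \<noteq> 0" "A = A'"
  using assms by (auto simp: on_snd_def ket_def split: if_splits)

lemma finite_on_fst:
  assumes "\<And>B. finite {A. T A B \<noteq> 0}"
  shows "finite {P. on_fst T P R \<noteq> 0}"
proof (rule finite_subset)
  show "{P. on_fst T P R \<noteq> 0} \<subseteq> {A. T A (fst R) \<noteq> 0} \<times> {snd R}"
    by (cases R) (auto dest: on_fst_nonzeroD)
qed (use assms in simp)

lemma finite_on_snd:
  assumes "\<And>B. finite {A. T A B \<noteq> 0}"
  shows "finite {P. on_snd T P R \<noteq> 0}"
proof (rule finite_subset)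
  show "{P. on_snd T P R \<noteq> 0} \<subseteq> {fst R} \<times> {B. T B (snd R) \<noteq> 0}"
    by (cases R) (auto dest: on_snd_nonzeroD)
qed (use assms in simp)

lemma lin_ext_nonzeroE:
  assumes "lin_ext T v B \<noteq> 0"
  obtains A where "v A \<noteq> 0" "T A B \<noteq> 0"
proof -
  obtain A where "v A * T A B \<noteq> 0"
    using assms unfolding lin_ext_def by (rule Sum_any.not_neutral_obtains_not_neutral)
  then show thesis by (intro that[of A]) auto
qed

lemma psi_psi_star_nonzeroE:
  fixes v :: "adm \<Rightarrow> 'k::comm_ring_1"
  assumes "psi r (psi_star s v) B \<noteq> 0"
  obtains A where "v A \<noteq> 0" "s \<in> modes A" "r \<notin> modes A - {s}"
    "modes B = insert r (modes A - {s})"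
proof -
  obtain C where C: "psi_star s v C \<noteq> 0" "psi_ket r C B \<noteq> (0 :: 'k)"
    using assms unfolding psi_def by (rule lin_ext_nonzeroE)
  obtain A where A: "v A \<noteq> 0" "psi_star_ket s A C \<noteq> (0 :: 'k)"
    using C(1) unfolding psi_star_def by (rule lin_ext_nonzeroE)
  show thesis
    using that[OF A(1)] psi_ket_nonzeroD[OF C(2)] psi_star_ket_nonzeroD[OF A(2)] by simp
qed

definition modes12 :: "adm \<times> adm \<Rightarrow> (nat \<times> int) set" where
  "modes12 P = Pair 1 ` modes (fst P) \<union> Pair 2 ` modes (snd P)"

lemma psi12_nonzeroE:
  fixes v :: "adm \<times> adm \<Rightarrow> 'k::comm_ring_1"
  assumes "psi12 i r v R \<noteq> 0" "i \<in> {1, 2}"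
  obtains P where "v P \<noteq> 0" "(i, r) \<notin> modes12 P" "modes12 R = insert (i, r) (modes12 P)"
proof -
  obtain P where P: "v P \<noteq> 0" "(if i = 1 then on_fst else on_snd) (psi_ket r) P R \<noteq> (0 :: 'k)"
    using assms(1) unfolding psi12_def by (rule lin_ext_nonzeroE)
  obtain A B A' B' where AB: "P = (A, B)" "R = (A', B')" by (cases P, cases R)
  from assms(2) have "i = 1 \<or> i = 2" by simp
  then have "(i, r) \<notin> modes12 P \<and> modes12 R = insert (i, r) (modes12 P)"
  proof
    assume i: "i = 1"
    then have "on_fst (psi_ket r) (A, B) (A', B') \<noteq> (0 :: 'k)" using P(2) AB by simp
    note D = on_fst_nonzeroD[OF this]
    show ?thesis using i AB D(2) psi_ket_nonzeroD[OF D(1)] by (auto simp: modes12_def)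
  next
    assume i: "i = 2"
    then have "on_snd (psi_ket r) (A, B) (A', B') \<noteq> (0 :: 'k)" using P(2) AB by simp
    note D = on_snd_nonzeroD[OF this]
    show ?thesis using i AB D(2) psi_ket_nonzeroD[OF D(1)] by (auto simp: modes12_def)
  qed
  then show thesis using that P(1) by blast
qed

lemma psi_star12_nonzeroE:
  fixes v :: "adm \<times> adm \<Rightarrow> 'k::comm_ring_1"
  assumes "psi_star12 i r v R \<noteq> 0" "i \<in> {1, 2}"
  obtains P where "v P \<noteq> 0" "(i, r) \<in> modes12 P" "modes12 R = modes12 P - {(i, r)}"
proof -
  obtain P where P: "v P \<noteq> 0"
    "(if i = 1 then on_fst else on_snd) (psi_star_ket r) P R \<noteq> (0 :: 'k)"
    using assms(1) unfolding psi_star12_def by (rule lin_ext_nonzeroE)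
  obtain A B A' B' where AB: "P = (A, B)" "R = (A', B')" by (cases P, cases R)
  from assms(2) have "i = 1 \<or> i = 2" by simp
  then have "(i, r) \<in> modes12 P \<and> modes12 R = modes12 P - {(i, r)}"
  proof
    assume i: "i = 1"
    then have "on_fst (psi_star_ket r) (A, B) (A', B') \<noteq> (0 :: 'k)" using P(2) AB by simp
    note D = on_fst_nonzeroD[OF this]
    show ?thesis
      using psi_star_ket_nonzeroD(1)[OF D(1)]
      unfolding i AB modes12_def fst_conv snd_conv psi_star_ket_nonzeroD(2)[OF D(1)] D(2)[symmetric]
      by auto
  next
    assume i: "i = 2"
    then have "on_snd (psi_star_ket r) (A, B) (A', B') \<noteq> (0 :: 'k)" using P(2) AB by simp
    note D = on_snd_nonzeroD[OF this]
    show ?thesis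
      using psi_star_ket_nonzeroD(1)[OF D(1)]
      unfolding i AB modes12_def fst_conv snd_conv psi_star_ket_nonzeroD(2)[OF D(1)] D(2)[symmetric]
      by auto
  qed
  then show thesis using that P(1) by blast
qed

lemma psi_psi_star12_nonzeroE:
  fixes v :: "adm \<times> adm \<Rightarrow> 'k::comm_ring_1"
  assumes "psi12 i r (psi_star12 j s v) R \<noteq> 0" "i \<in> {1, 2}" "j \<in> {1, 2}"
  obtains P where "v P \<noteq> 0" "(j, s) \<in> modes12 P" "(i, r) \<notin> modes12 P - {(j, s)}"
    "modes12 R = insert (i, r) (modes12 P - {(j, s)})"
proof -
  obtain S where S: "psi_star12 j s v S \<noteq> 0" "(i, r) \<notin> modes12 S"
    "modes12 R = insert (i, r) (modes12 S)"
    using assms(1,2) by (rule psi12_nonzeroE)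
  obtain P where P: "v P \<noteq> 0" "(j, s) \<in> modes12 P" "modes12 S = modes12 P - {(j, s)}"
    using S(1) assms(3) by (rule psi_star12_nonzeroE)
  show thesis
    using that[OF P(1,2)] S(2,3) unfolding P(3) by blast
qed

lemma finite_psi12:
  "finite {P. (if i = 1 then on_fst else on_snd) (psi_ket r) P R \<noteq> (0 :: 'k::comm_ring_1)}"
  for i :: nat
  using finite_on_fst[of "psi_ket r" R, OF finite_psi_ket]
    finite_on_snd[of "psi_ket r" R, OF finite_psi_ket] by (cases "i = 1") simp_all

lemma finite_psi_star12:
  "finite {P. (if i = 1 then on_fst else on_snd) (psi_star_ket r) P R \<noteq> (0 :: 'k::comm_ring_1)}"
  for i :: nat
  using finite_on_fst[of "psi_star_ket r" R, OF finite_psi_star_ket]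
    finite_on_snd[of "psi_star_ket r" R, OF finite_psi_star_ket] by (cases "i = 1") simp_all

lemma finite_particles: "finite {m. int m \<in> modes A}"
proof (rule finite_subset)
  show "{m. int m \<in> modes A} \<subseteq> nat ` (modes A - {..<0})" by force
qed (use modes[of A] in simp)

lemma finite_holes: "finite {n. - int n - 1 \<notin> modes A}"
proof (rule finite_subset)
  show "{n. - int n - 1 \<notin> modes A} \<subseteq> (\<lambda>s. nat (- s - 1)) ` ({..<0} - modes A)" by force
qed (use modes[of A] in simp)

lemma finite_quad:
  fixes c :: "nat \<Rightarrow> nat \<Rightarrow> 'k::comm_ring_1"
  shows "finite {(m, n). c m n * psi (int m) (psi_star (- int n - 1) v) B \<noteq> 0}"
proof (rule finite_subset)
  show "{(m, n). c m n * psi (int m) (psi_star (- int n - 1) v) B \<noteq> 0}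
      \<subseteq> {m. int m \<in> modes B} \<times> {n. - int n - 1 \<notin> modes B}"
  proof clarsimp
    fix m n assume "c m n * psi (int m) (psi_star (- int n - 1) v) B \<noteq> 0"
    then have "psi (int m) (psi_star (- int n - 1) v) B \<noteq> 0" by auto
    then show "int m \<in> modes B \<and> - int n - 1 \<notin> modes B"
      by (rule psi_psi_star_nonzeroE) simp
  qed
qed (simp add: finite_particles finite_holes)

lemma finite_quad12:
  fixes c :: "nat \<Rightarrow> nat \<Rightarrow> 'k::comm_ring_1"
  assumes ij: "i \<in> {1, 2}" "j \<in> {1, 2}"
  shows "finite {(m, n). c m n * psi12 i (int m) (psi_star12 j (- int n - 1) v) R \<noteq> 0}"
proof (rule finite_subset)
  show "{(m, n). c m n * psi12 i (int m) (psi_star12 j (- int n - 1) v) R \<noteq> 0}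
      \<subseteq> {m. (i, int m) \<in> modes12 R} \<times> {n. (j, - int n - 1) \<notin> modes12 R}"
  proof clarsimp
    fix m n assume "c m n * psi12 i (int m) (psi_star12 j (- int n - 1) v) R \<noteq> 0"
    then have "psi12 i (int m) (psi_star12 j (- int n - 1) v) R \<noteq> 0" by auto
    then show "(i, int m) \<in> modes12 R \<and> (j, - int n - 1) \<notin> modes12 R"
      using ij by (rule psi_psi_star12_nonzeroE) simp
  qed
  have "finite {m. (i, int m) \<in> modes12 R}"
    using ij(1) finite_particles by (auto simp: modes12_def image_iff)
  moreover have "finite {n. (j, - int n - 1) \<notin> modes12 R}"
    using ij(2) finite_holes by (auto simp: modes12_def image_iff)
  ultimately show "finite ({m. (i, int m) \<in> modes12 R} \<times> {n. (j, - int n - 1) \<notin> modes12 R})"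
    by simp
qed

lemma quad_nonzeroE:
  assumes "quad c v B \<noteq> 0"
  obtains A m n where "v A \<noteq> 0" "- int n - 1 \<in> modes A" "int m \<notin> modes A"
    "modes B = insert (int m) (modes A - {- int n - 1})"
proof -
  obtain m n where mn: "c m n * psi (int m) (psi_star (- int n - 1) v) B \<noteq> 0"
    using assms unfolding quad_def
    by (rule Sum_any.not_neutral_obtains_not_neutral) auto
  then have "psi (int m) (psi_star (- int n - 1) v) B \<noteq> 0" by auto
  then show thesis
    by (rule psi_psi_star_nonzeroE) (use that in auto)
qed

lemma quad_pow_nonzeroD:
  assumes "(quad c ^^ k) (ket vac) B \<noteq> 0"
  shows "card (modes B - {..<0}) = k"
  using assms
proof (induction k arbitrary: B)
  case 0
  then show ?case by (auto simp: ket_def split: if_splits)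
next
  case (Suc k)
  from Suc.prems have "quad c ((quad c ^^ k) (ket vac)) B \<noteq> 0" by simp
  then obtain A m n where A: "(quad c ^^ k) (ket vac) A \<noteq> 0" "- int n - 1 \<in> modes A"
    "int m \<notin> modes A"
    "modes B = insert (int m) (modes A - {- int n - 1})"
    by (rule quad_nonzeroE)
  have "modes B - {..<0} = insert (int m) (modes A - {..<0})" unfolding A(4) by auto
  moreover have "finite (modes A - {..<0})" using modes[of A] by simp
  ultimately show ?case using Suc.IH[OF A(1)] A(3) by simp
qed

lemma quad12_nonzeroE:
  assumes "quad12 c v R \<noteq> 0"
  obtains P i m j n where "v P \<noteq> 0" "i \<in> {1, 2}" "j \<in> {1, 2}"
    "(j, - int n - 1) \<in> modes12 P" "(i, int m) \<notin> modes12 P"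
    "modes12 R = insert (i, int m) (modes12 P - {(j, - int n - 1)})"
proof -
  from assms obtain i where i: "i \<in> {1, 2}" "(\<Sum>j\<in>{1, 2}.
      Sum_any (\<lambda>(m, n). c i j m n * psi12 i (int m) (psi_star12 j (- int n - 1) v) R)) \<noteq> 0"
    unfolding quad12_def by (rule sum.not_neutral_contains_not_neutral)
  from i(2) obtain j where j: "j \<in> {1, 2}"
    "Sum_any (\<lambda>(m, n). c i j m n * psi12 i (int m) (psi_star12 j (- int n - 1) v) R) \<noteq> 0"
    by (rule sum.not_neutral_contains_not_neutral)
  from j(2) obtain m n where "c i j m n * psi12 i (int m) (psi_star12 j (- int n - 1) v) R \<noteq> 0"
    by (rule Sum_any.not_neutral_obtains_not_neutral) auto
  then have "psi12 i (int m) (psi_star12 j (- int n - 1) v) R \<noteq> 0" by auto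
  from this i(1) j(1) show thesis
    by (rule psi_psi_star12_nonzeroE) (use that i(1) j(1) in auto)
qed

lemma quad12_pow_nonzeroD:
  assumes "(quad12 c ^^ k) (ket (vac, vac)) R \<noteq> 0"
  shows "card (modes12 R - UNIV \<times> {..<0}) = k" "finite (modes12 R - UNIV \<times> {..<0})"
proof -
  have "card (modes12 R - UNIV \<times> {..<0}) = k \<and> finite (modes12 R - UNIV \<times> {..<0})"
    using assms
  proof (induction k arbitrary: R)
    case 0
    then have "R = (vac, vac)" by (auto simp: ket_def split: if_splits)
    then have "modes12 R - UNIV \<times> {..<0} = {}" by (auto simp: modes12_def)
    then show ?case by (simp only: card.empty finite.emptyI)
  next
    case (Suc k)
    from Suc.prems have "quad12 c ((quad12 c ^^ k) (ket (vac, vac))) R \<noteq> 0" by simp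
    then obtain P i m j n where P: "(quad12 c ^^ k) (ket (vac, vac)) P \<noteq> 0"
      "i \<in> {1, 2}" "j \<in> {1, 2}" "(j, - int n - 1) \<in> modes12 P" "(i, int m) \<notin> modes12 P"
      "modes12 R = insert (i, int m) (modes12 P - {(j, - int n - 1)})"
      by (rule quad12_nonzeroE)
    have "modes12 R - UNIV \<times> {..<0} = insert (i, int m) (modes12 P - UNIV \<times> {..<0})"
      unfolding P(6) by auto
    then show ?case using Suc.IH[OF P(1)] P(5) by simp
  qed
  then show "card (modes12 R - UNIV \<times> {..<0}) = k" "finite (modes12 R - UNIV \<times> {..<0})"
    by simp_all
qed

lemma finite_bogoliubov:
  fixes c :: "nat \<Rightarrow> nat \<Rightarrow> 'k::comm_rat_algebra_1"
  shows "finite {k. scaleQ (1 / fact k) ((quad c ^^ k) (ket vac) B) \<noteq> 0}"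
proof (rule finite_subset)
  show "{k. scaleQ (1 / fact k) ((quad c ^^ k) (ket vac) B) \<noteq> 0} \<subseteq> {card (modes B - {..<0})}"
  proof clarify
    fix k assume "scaleQ (1 / fact k) ((quad c ^^ k) (ket vac) B) \<noteq> 0"
    then have "(quad c ^^ k) (ket vac) B \<noteq> 0" by auto
    then show "k = card (modes B - {..<0})" by (rule quad_pow_nonzeroD[symmetric])
  qed
qed simp

lemma finite_bogoliubov12:
  fixes c :: "nat \<Rightarrow> nat \<Rightarrow> nat \<Rightarrow> nat \<Rightarrow> 'k::comm_rat_algebra_1"
  shows "finite {k. scaleQ (1 / fact k) ((quad12 c ^^ k) (ket (vac, vac)) R) \<noteq> 0}"
proof (rule finite_subset)
  show "{k. scaleQ (1 / fact k) ((quad12 c ^^ k) (ket (vac, vac)) R) \<noteq> 0}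
      \<subseteq> {card (modes12 R - UNIV \<times> {..<0})}"
  proof clarify
    fix k assume "scaleQ (1 / fact k) ((quad12 c ^^ k) (ket (vac, vac)) R) \<noteq> 0"
    then have "(quad12 c ^^ k) (ket (vac, vac)) R \<noteq> 0" by auto
    then show "k = card (modes12 R - UNIV \<times> {..<0})" by (rule quad12_pow_nonzeroD(1)[symmetric])
  qed
qed simp

lemma fps_nth_Sum_any_nonzeroE:
  assumes "fps_nth (Sum_any f) n \<noteq> 0"
  obtains a where "fps_nth (f a) n \<noteq> 0"
proof -
  have "(\<Sum>a | f a \<noteq> 0. fps_nth (f a) n) \<noteq> 0"
    using assms by (simp add: Sum_any.expand_set fps_sum_nth)
  then show thesis by (rule sum.not_neutral_contains_not_neutral) (use that in blast)
qed

lemma fps_mult_sign_ket_nonzeroD: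
  fixes f :: "'k::comm_ring_1 fps"
  assumes "fps_nth (f * ((- 1) ^ k * ket A B)) n \<noteq> 0"
  shows "fps_nth f n \<noteq> 0"
  using assms by (cases "even k") (auto simp: ket_def split: if_splits)

lemma fps_mult_psi_ket_nonzeroD:
  fixes f :: "'k::comm_ring_1 fps"
  assumes "fps_nth (f * psi_ket r A B) n \<noteq> 0"
  shows "fps_nth f n \<noteq> 0" "modes B = insert r (modes A)"
proof -
  have nz: "psi_ket r A B \<noteq> (0 :: 'k fps)" using assms by auto
  show "modes B = insert r (modes A)" by (rule psi_ket_nonzeroD(2)[OF nz])
  have "psi_ket r A B = (- 1) ^ card {a \<in> modes A. r < a} * (ket (Adm (insert r (modes A))) B :: 'k fps)"
    using psi_ket_nonzeroD(1)[OF nz] by (simp only: psi_ket_def if_False)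
  with assms show "fps_nth f n \<noteq> 0" by (metis fps_mult_sign_ket_nonzeroD)
qed

lemma fps_mult_psi_star_ket_nonzeroD:
  fixes f :: "'k::comm_ring_1 fps"
  assumes "fps_nth (f * psi_star_ket r A B) n \<noteq> 0"
  shows "fps_nth f n \<noteq> 0" "modes B = modes A - {r}"
proof -
  have nz: "psi_star_ket r A B \<noteq> (0 :: 'k fps)" using assms by auto
  show "modes B = modes A - {r}" by (rule psi_star_ket_nonzeroD(2)[OF nz])
  have "psi_star_ket r A B =
      (- 1) ^ (card {a \<in> modes A. r \<le> a} + 1) * (ket (Adm (modes A - {r})) B :: 'k fps)"
    using psi_star_ket_nonzeroD(1)[OF nz] by (simp only: psi_star_ket_def if_True)
  with assms show "fps_nth f n \<noteq> 0" by (metis fps_mult_sign_ket_nonzeroD)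
qed

lemma fps_psi_psi_star_nonzeroE:
  fixes v :: "adm \<Rightarrow> 'k::comm_ring_1 fps"
  assumes "fps_nth (psi r (psi_star s v) B) N \<noteq> 0"
  obtains A where "fps_nth (v A) N \<noteq> 0" "modes B = insert r (modes A - {s})"
proof -
  obtain C where C: "fps_nth (psi_star s v C * psi_ket r C B) N \<noteq> 0"
    using assms unfolding psi_def lin_ext_def by (rule fps_nth_Sum_any_nonzeroE)
  from fps_mult_psi_ket_nonzeroD(1)[OF C]
  obtain A where A: "fps_nth (v A * psi_star_ket s A C) N \<noteq> 0"
    unfolding psi_star_def lin_ext_def by (rule fps_nth_Sum_any_nonzeroE)
  show thesis
    by (rule that[OF fps_mult_psi_star_ket_nonzeroD(1)[OF A]])
      (simp only: fps_mult_psi_ket_nonzeroD(2)[OF C] fps_mult_psi_star_ket_nonzeroD(2)[OF A])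
qed

lemma scaleQ_fps_nth [simp]: "fps_nth (scaleQ a f) n = scaleQ a (fps_nth f n)"
  by (simp add: scaleQ_fps_def)

context
  fixes A :: "nat \<Rightarrow> nat \<Rightarrow> 'k::comm_rat_algebra_1" and c :: "nat \<Rightarrow> nat \<Rightarrow> 'k fps"
  defines "c \<equiv> \<lambda>m n. fps_X ^ (m + n + 1) * fps_const (A m n)"
begin

lemma quad_pow_nth_nonzeroD:
  assumes "fps_nth ((quad c ^^ k) (ket vac) B) N \<noteq> 0"
  shows "modes B \<subseteq> {..<int N}" "{..< - int N} \<subseteq> modes B"
proof -
  have "modes B \<subseteq> {..<int N} \<and> {..< - int N} \<subseteq> modes B"
    using assms
  proof (induction k arbitrary: B N)
    case 0
    then have "B = vac" by (auto simp: ket_def split: if_splits)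
    then show ?case by auto
  next
    case (Suc k)
    let ?w = "(quad c ^^ k) (ket vac)"
    from Suc.prems have "fps_nth (quad c ?w B) N \<noteq> 0" by simp
    then obtain m n where mn: "fps_nth (c m n * psi (int m) (psi_star (- int n - 1) ?w) B) N \<noteq> 0"
      unfolding quad_def by (rule fps_nth_Sum_any_nonzeroE) auto
    define M where "M = N - (m + n + 1)"
    have "c m n * psi (int m) (psi_star (- int n - 1) ?w) B =
        fps_X ^ (m + n + 1) * (fps_const (A m n) * psi (int m) (psi_star (- int n - 1) ?w) B)"
      by (simp add: c_def mult.assoc)
    with mn have "N \<ge> m + n + 1"
      and "A m n * fps_nth (psi (int m) (psi_star (- int n - 1) ?w) B) M \<noteq> 0"
      by (auto simp only: fps_X_power_mult_nth fps_mult_left_const_nth M_def split: if_splits)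
    then have N: "N = M + m + n + 1"
      and "fps_nth (psi (int m) (psi_star (- int n - 1) ?w) B) M \<noteq> 0"
      by (auto simp: M_def)
    then obtain C where C: "fps_nth (?w C) M \<noteq> 0"
      "modes B = insert (int m) (modes C - {- int n - 1})"
      by (elim fps_psi_psi_star_nonzeroE)
    show ?case using Suc.IH[OF C(1)] C(2) N by auto
  qed
  then show "modes B \<subseteq> {..<int N}" "{..< - int N} \<subseteq> modes B" by simp_all
qed

lemma bogoliubov_nth_nonzeroD:
  assumes "fps_nth (bogoliubov c B) N \<noteq> 0"
  shows "modes B \<subseteq> {..<int N}" "{..< - int N} \<subseteq> modes B"
proof -
  from assms obtain k where "fps_nth (scaleQ (1 / fact k) ((quad c ^^ k) (ket vac) B)) N \<noteq> 0"
    unfolding bogoliubov_def op_exp_def by (rule fps_nth_Sum_any_nonzeroE)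
  then have "fps_nth ((quad c ^^ k) (ket vac) B) N \<noteq> 0" by auto
  then show "modes B \<subseteq> {..<int N}" "{..< - int N} \<subseteq> modes B"
    by (auto dest: quad_pow_nth_nonzeroD)
qed

lemma finite_inner_fock: "finite {B. fps_nth (fps_const (v B) * bogoliubov c B) N \<noteq> 0}"
proof (rule finite_subset)
  show "{B. fps_nth (fps_const (v B) * bogoliubov c B) N \<noteq> 0}
      \<subseteq> (\<lambda>S. Adm ({..< - int N} \<union> S)) ` Pow {- int N..<int N}"
  proof clarify
    fix B assume "fps_nth (fps_const (v B) * bogoliubov c B) N \<noteq> 0"
    then have "fps_nth (bogoliubov c B) N \<noteq> 0" by auto
    note B = bogoliubov_nth_nonzeroD[OF this]
    have "{..< - int N} \<union> (modes B - {..< - int N}) = modes B" using B(2) by auto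
    then have "B = Adm ({..< - int N} \<union> (modes B - {..< - int N}))"
      by (simp add: modes_inverse)
    moreover have "modes B - {..< - int N} \<in> Pow {- int N..<int N}" using B(1) by auto
    ultimately show "B \<in> (\<lambda>S. Adm ({..< - int N} \<union> S)) ` Pow {- int N..<int N}" by blast
  qed
qed simp

lemma bogoliubov_vac: "bogoliubov a vac = 1" for a :: "nat \<Rightarrow> nat \<Rightarrow> 'l::comm_rat_algebra_1"
proof -
  have "scaleQ (1 / fact k) ((quad a ^^ k) (ket vac) vac) = (if k = 0 then 1 else 0)" for k
  proof (cases "k = 0")
    case False
    then have "(quad a ^^ k) (ket vac) vac = 0"
      using quad_pow_nonzeroD[where c = a and k = k and B = vac] by auto
    with False show ?thesis by (simp only: scaleQ_zero_right if_False)
  qed (simp add: ket_def scaleQ_one)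
  then show ?thesis by (simp add: bogoliubov_def op_exp_def)
qed

text \<open>
  The constant term of this series is \<open>1\<close>; so, with \<open>V\<^sub>0\<close> denoting the series,
  \<open>fps_right_inverse V\<^sub>0 1\<close> is its inverse in the ring of power series.
\<close>

lemma inner_fock_bogoliubov_nth_0: "fps_nth (inner_fock (bogoliubov a) (bogoliubov c)) 0 = 1"
proof -
  have "fps_nth (fps_const (bogoliubov a B) * bogoliubov c B) 0 = (if B = vac then 1 else 0)" for B
  proof (cases "B = vac")
    case False
    have "fps_nth (bogoliubov c B) 0 = 0"
    proof (rule ccontr)
      assume "fps_nth (bogoliubov c B) 0 \<noteq> 0"
      from bogoliubov_nth_nonzeroD[OF this] have "modes B = {..<0}" by auto
      with False show False by (metis modes_inject modes_vac)
    qed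
    with False show ?thesis by simp
  qed (simp add: bogoliubov_vac)
  then show ?thesis by (simp add: inner_fock_def)
qed

end

end

(*
The vector v = exp(sum R_mn psi_m psi*_{-n-1})|0> is killed by psi_{-n-1} + sum_m R_mn psi_m for
every n.  Conversely, by induction on the number of holes, a vector killed by these operators is
determined by its coefficients at the basis vectors without holes, so among vectors of charge 0 it
is a multiple of v.  It therefore suffices to find such operators killing the partial inner product.

Put u_n = (psi^2_{-n-1} V1, V2).  Pairing the equations of V1 with V2 expresses both u_n and
psi^1_{-n-1}(V1, V2) linearly through the vectors psi^1_m (V1, V2) and t_m = (psi^2_m V1, V2).
Moving psi^2_m to V2, the particle-hole dual equations of V2 give
t_m = sum_k Q^{m+k+1} A_mk u_k.  Hence u solves a linear fixed point equation that is contracting in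
the Q-adic topology; its solution is a combination of the psi^1_m (V1, V2) with coefficients in
K[[Q]], and eliminating u yields the required operators.
*)
theory Submission
  imports Defs
begin

section \<open>Rational scalars and finite sums\<close>

lemma scaleQ_sum: "scaleQ a (sum f S) = (\<Sum>i\<in>S. scaleQ a (f i :: 'a :: comm_rat_algebra_1))"
  by (induction S rule: infinite_finite_induct) (simp_all add: scaleQ_add_right)

lemma mult_scaleQ_right: "x * scaleQ a y = scaleQ a (x * y :: 'a :: comm_rat_algebra_1)"
  by (metis mult.commute mult_scaleQ_left)

lemma scaleQ_minus_right: "scaleQ a (- x) = - scaleQ a (x :: 'a :: comm_rat_algebra_1)"
  using scaleQ_add_right[of a x "- x"] by (simp add: eq_neg_iff_add_eq_0 add.commute)

lemma scaleQ_zero_left: "scaleQ 0 x = (0 :: 'a :: comm_rat_algebra_1)"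
  using scaleQ_add_left[of 0 0 x] by simp

lemma scaleQ_of_nat: "scaleQ (of_nat n) x = of_nat n * (x :: 'a :: comm_rat_algebra_1)"
  by (induction n) (simp_all add: scaleQ_zero_left scaleQ_add_left scaleQ_one algebra_simps)

lemma scaleQ_fact_Suc:
  "scaleQ (1 / fact (Suc k)) (of_nat (Suc k) * x) = scaleQ (1 / fact k) (x :: 'a :: comm_rat_algebra_1)"
proof -
  have "scaleQ (1 / fact (Suc k)) (of_nat (Suc k) * x)
      = scaleQ (1 / fact (Suc k) * of_nat (Suc k)) x"
    by (simp only: scaleQ_of_nat[symmetric] scaleQ_scaleQ)
  also have "1 / fact (Suc k) * of_nat (Suc k) = (1 / fact k :: rat)"
    by (simp add: field_simps del: of_nat_Suc)
  finally show ?thesis .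
qed

lemma Sum_any_eq_sum:
  assumes "finite S" "\<And>x. x \<notin> S \<Longrightarrow> f x = 0"
  shows "Sum_any f = sum f S"
  by (rule Sum_any.expand_superset) (use assms in auto)

text \<open>
  Some facts about the fermion modes obtained by interpretation do not mention the coefficient ring
  in their statement; they need an inhabitant of its type class.
\<close>

instantiation rat :: comm_rat_algebra_1
begin

definition scaleQ_rat :: "rat \<Rightarrow> rat \<Rightarrow> rat" where "scaleQ_rat = (*)"

instance
  by standard (simp_all add: scaleQ_rat_def algebra_simps)

end

section \<open>Creation and annihilation operators on abstract modes\<close>

text \<open>
  One and two components are treated at once. The basis is indexed by \<open>'b\<close>, \<open>tog r\<close> toggles the
  occupation of the mode \<open>r\<close>, and \<open>P\<close> is the set of modes that are empty in the vacuum. The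
  assumptions are invariant under exchanging occupied and empty modes (and \<open>P\<close> and \<open>- P\<close>).
\<close>

locale fermions =
  fixes occ :: "'b \<Rightarrow> 'm set"
    and tog :: "'m \<Rightarrow> 'b \<Rightarrow> 'b"
    and sg :: "'m \<Rightarrow> 'b \<Rightarrow> 'k :: comm_rat_algebra_1"
    and P :: "'m set"
    and vac0 :: 'b
  assumes inj_occ: "occ A = occ B \<Longrightarrow> A = B"
    and occ_tog: "occ (tog r B) = (if r \<in> occ B then occ B - {r} else insert r (occ B))"
    and sg_sq: "sg r B * sg r B = 1"
    and sg_tog: "sg r (tog r B) = sg r B"
    and sg_anti: "r \<noteq> s \<Longrightarrow> sg r B * sg s (tog r B) = - (sg s B * sg r (tog s B))"
    and finite_occ_Int: "finite (occ B \<inter> P)"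
    and finite_compl_occ: "finite (- P - occ B)"
    and occ_vac: "occ vac0 = - P"
begin

text \<open>Operators act on coefficient functions, so the value at \<open>B\<close> is read off at
  the source \<open>tog r B\<close>. The sign may be taken at \<open>B\<close> because
  \<open>sg_tog\<close> makes it the same at both ends.\<close>

definition cr :: "'m \<Rightarrow> ('b \<Rightarrow> 'k) \<Rightarrow> 'b \<Rightarrow> 'k" where
  "cr r v B = (if r \<in> occ B then sg r B * v (tog r B) else 0)"

definition an :: "'m \<Rightarrow> ('b \<Rightarrow> 'k) \<Rightarrow> 'b \<Rightarrow> 'k" where
  "an r v B = (if r \<in> occ B then 0 else sg r B * v (tog r B))"

definition parts :: "'b \<Rightarrow> 'm set" where "parts B = occ B \<inter> P"

definition holes :: "'b \<Rightarrow> 'm set" where "holes B = - P - occ B"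

text \<open>The possibly infinite quadratic operator becomes a finite sum at each \<open>B\<close>:
  the created mode must be occupied in \<open>B\<close> and the removed one empty.\<close>

definition X :: "('m \<Rightarrow> 'm \<Rightarrow> 'k) \<Rightarrow> ('b \<Rightarrow> 'k) \<Rightarrow> 'b \<Rightarrow> 'k" where
  "X c v B = (\<Sum>p\<in>parts B. \<Sum>h\<in>holes B. c p h * cr p (an h v) B)"

text \<open>This is the commutator of \<open>X c\<close> with \<open>cr h\<close>, see
  \<open>cr_X\<close>.\<close>

definition Y :: "('m \<Rightarrow> 'm \<Rightarrow> 'k) \<Rightarrow> 'm \<Rightarrow> ('b \<Rightarrow> 'k) \<Rightarrow> 'b \<Rightarrow> 'k" where
  "Y c h v B = (\<Sum>p\<in>parts B. c p h * cr p v B)"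

text \<open>In the exponential series only the power equal to the number of particles of
  \<open>B\<close> reaches \<open>B\<close>; \<open>op_exp_X\<close> confirms that this is the whole
  exponential.\<close>

definition bog :: "('m \<Rightarrow> 'm \<Rightarrow> 'k) \<Rightarrow> 'b \<Rightarrow> 'k" where
  "bog c B = scaleQ (1 / fact (card (parts B))) ((X c ^^ card (parts B)) (ket vac0) B)"

lemma tog_tog [simp]: "tog r (tog r B) = B"
  by (rule inj_occ) (auto simp: occ_tog)

lemma tog_commute: "tog r (tog s B) = tog s (tog r B)"
  by (rule inj_occ) (auto simp: occ_tog)

lemma occ_tog_iff: "s \<in> occ (tog r B) \<longleftrightarrow> (if s = r then r \<notin> occ B else s \<in> occ B)"
  by (auto simp: occ_tog)

lemma finite_parts [simp]: "finite (parts B)"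
  by (simp add: parts_def finite_occ_Int)

lemma finite_holes [simp]: "finite (holes B)"
  by (simp add: holes_def finite_compl_occ)

lemma parts_tog_hole: "h \<notin> P \<Longrightarrow> parts (tog h B) = parts B"
  by (auto simp: parts_def occ_tog)

lemma parts_tog_part: "p \<in> parts B \<Longrightarrow> parts (tog p B) = parts B - {p}"
  by (auto simp: parts_def occ_tog)

lemma holes_tog_part: "p \<in> P \<Longrightarrow> holes (tog p B) = holes B"
  by (auto simp: holes_def occ_tog)

lemma holes_tog_hole: "h \<in> holes B \<Longrightarrow> holes (tog h B) = holes B - {h}"
  by (auto simp: holes_def occ_tog)

lemma cr_an: "r \<noteq> s \<Longrightarrow> cr r (an s v) B = - an s (cr r v) B"
  using sg_anti[of r s B] tog_commute[of r s B]
  by (auto simp: cr_def an_def occ_tog_iff mult.assoc[symmetric])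

lemma cr_cr: "cr r (cr s v) B = - cr s (cr r v) B"
  using sg_anti[of r s B] tog_commute[of r s B]
  by (cases "r = s") (auto simp: cr_def occ_tog_iff mult.assoc[symmetric])

lemma cr_an_same: "cr r (an r v) B + an r (cr r v) B = v B"
  by (simp add: cr_def an_def occ_tog_iff sg_tog mult.assoc[symmetric] sg_sq)

lemma cr_sum_sum:
  "cr r (\<lambda>B. \<Sum>i\<in>I. \<Sum>j\<in>J. a i j * f i j B) B = (\<Sum>i\<in>I. \<Sum>j\<in>J. a i j * cr r (f i j) B)"
  by (simp add: cr_def sum_distrib_left mult.left_commute)

lemma cr_cong: "(r \<in> occ B \<Longrightarrow> v (tog r B) = w (tog r B)) \<Longrightarrow> cr r v B = cr r w B"
  by (simp add: cr_def)

lemma an_cong: "(r \<notin> occ B \<Longrightarrow> v (tog r B) = w (tog r B)) \<Longrightarrow> an r v B = an r w B"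
  by (simp add: an_def)

section \<open>Commutators with the quadratic operator\<close>

text \<open>The added terms vanish. A common index set for \<open>B\<close> and a toggled state is
  what allows operators to be moved through the sum.\<close>

lemma X_eq_sum:
  assumes "finite G" "finite F" "parts B \<subseteq> G" "G \<subseteq> P" "holes B \<subseteq> F" "F \<subseteq> - P"
  shows "X c v B = (\<Sum>p\<in>G. \<Sum>h\<in>F. c p h * cr p (an h v) B)"
proof -
  have "(\<Sum>p\<in>G. \<Sum>h\<in>F. c p h * cr p (an h v) B)
      = (\<Sum>p\<in>parts B. \<Sum>h\<in>F. c p h * cr p (an h v) B)"
    by (rule sum.mono_neutral_right) (use assms in \<open>auto simp: parts_def cr_def intro!: sum.neutral split: if_splits\<close>)
  also have "\<dots> = X c v B"
    unfolding X_def
    by (intro sum.cong sum.mono_neutral_right refl)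
      (use assms in \<open>auto simp: holes_def parts_def cr_def an_def occ_tog_iff\<close>)
  finally show ?thesis by simp
qed

lemma Y_eq_sum:
  assumes "finite G" "parts B \<subseteq> G" "G \<subseteq> P"
  shows "Y c h v B = (\<Sum>p\<in>G. c p h * cr p v B)"
  unfolding Y_def
  by (rule sum.mono_neutral_left) (use assms in \<open>auto simp: parts_def cr_def\<close>)

text \<open>Moving \<open>cr h\<close> past \<open>cr p\<close> and then past \<open>an h'\<close>
  produces two signs that cancel; the second anticommutator contributes the Kronecker delta.\<close>

lemma cr_cr_an:
  assumes "p \<in> P" "h \<notin> P" "h' \<notin> P"
  shows "cr h (cr p (an h' v)) B = cr p (an h' (cr h v)) B - (if h = h' then cr p v B else 0)"
proof -
  have "an h' (cr h v) C = (if h = h' then v C else 0) - cr h (an h' v) C" for C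
    using cr_an_same[of h v C] cr_an[of h h' v C] by (auto simp: algebra_simps)
  then have "cr p (an h' (cr h v)) B = cr p (\<lambda>C. (if h = h' then v C else 0) - cr h (an h' v) C) B"
    by (intro cr_cong) auto
  also have "\<dots> = (if h = h' then cr p v B else 0) - cr p (cr h (an h' v)) B"
    by (auto simp: cr_def algebra_simps)
  also have "cr p (cr h (an h' v)) B = - cr h (cr p (an h' v)) B"
    by (rule cr_cr)
  finally show ?thesis by simp
qed

lemma cr_X:
  assumes h: "h \<notin> P"
  shows "cr h (X c v) B = X c (cr h v) B - Y c h v B"
proof -
  \<comment> \<open>Toggling \<open>h\<close> may turn it into a hole, so \<open>h\<close> is added
    to make \<open>?F\<close> serve both \<open>B\<close> and \<open>tog h B\<close>.\<close>
  let ?G = "parts B" and ?F = "insert h (holes B)"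
  have F: "finite ?F" "?F \<subseteq> - P" "holes B \<subseteq> ?F" "?G \<subseteq> P" "holes (tog h B) \<subseteq> ?F"
    using h finite_holes[of B] by (auto simp: holes_def parts_def occ_tog_iff)
  have "cr h (X c v) B = cr h (\<lambda>C. \<Sum>p\<in>?G. \<Sum>h'\<in>?F. c p h' * cr p (an h' v) C) B"
    by (rule cr_cong, subst X_eq_sum[of ?G ?F]) (use F h in \<open>auto simp: parts_tog_hole\<close>)
  also have "\<dots> = (\<Sum>p\<in>?G. \<Sum>h'\<in>?F. c p h' * cr h (cr p (an h' v)) B)"
    by (rule cr_sum_sum)
  also have "\<dots> = (\<Sum>p\<in>?G. \<Sum>h'\<in>?F. c p h' * cr p (an h' (cr h v)) B
      - (if h = h' then c p h' * cr p v B else 0))"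
    by (intro sum.cong refl, subst cr_cr_an)
      (use F h in \<open>auto simp: parts_def holes_def algebra_simps\<close>)
  also have "\<dots> = X c (cr h v) B - Y c h v B"
    by (subst X_eq_sum[of ?G ?F]) (use F in \<open>auto simp: sum_subtractf Y_def\<close>)
  finally show ?thesis .
qed

text \<open>A creation operator \<open>cr q\<close> with \<open>q\<close> in \<open>P\<close>
  anticommutes with both factors of each term of \<open>X c\<close>, the modes \<open>q\<close> and
  \<open>h'\<close> being distinct, so it commutes with the product.\<close>

lemma X_Y:
  assumes h: "h \<notin> P"
  shows "X c (Y c h v) B = Y c h (X c v) B"
proof -
  let ?G = "parts B" and ?F = "holes B"
  have G: "?G \<subseteq> P" "?F \<subseteq> - P" by (auto simp: parts_def holes_def)
  have "X c (Y c h v) B = (\<Sum>p\<in>?G. \<Sum>h'\<in>?F. \<Sum>q\<in>?G. c p h' * (c q h * cr p (an h' (cr q v)) B))"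
    unfolding X_def
  proof (intro sum.cong refl)
    fix p h' assume ph: "p \<in> ?G" "h' \<in> ?F"
    have "cr p (an h' (Y c h v)) B = cr p (an h' (\<lambda>C. \<Sum>q\<in>?G. c q h * cr q v C)) B"
      by (intro cr_cong an_cong, subst Y_eq_sum[of ?G])
        (use ph G in \<open>auto simp: parts_tog_hole parts_tog_part holes_def\<close>)
    also have "\<dots> = (\<Sum>q\<in>?G. c q h * cr p (an h' (cr q v)) B)"
      by (simp add: cr_def an_def sum_distrib_left mult.left_commute)
    finally show "c p h' * cr p (an h' (Y c h v)) B
        = (\<Sum>q\<in>?G. c p h' * (c q h * cr p (an h' (cr q v)) B))"
      by (simp add: sum_distrib_left)
  qed
  also have "\<dots> = (\<Sum>p\<in>?G. \<Sum>h'\<in>?F. \<Sum>q\<in>?G. c p h' * (c q h * cr q (cr p (an h' v)) B))"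
  proof (intro sum.cong refl)
    fix p h' q assume *: "p \<in> ?G" "h' \<in> ?F" "q \<in> ?G"
    then have "q \<noteq> h'" using G by auto
    then have "an h' (cr q v) C = - cr q (an h' v) C" for C
      by (simp add: cr_an)
    then have "cr p (an h' (cr q v)) B = - cr p (cr q (an h' v)) B"
      by (simp add: cr_def)
    then show "c p h' * (c q h * cr p (an h' (cr q v)) B) = c p h' * (c q h * cr q (cr p (an h' v)) B)"
      by (simp add: cr_cr[of p q])
  qed
  also have "\<dots> = (\<Sum>q\<in>?G. c q h * (\<Sum>p\<in>?G. \<Sum>h'\<in>?F. c p h' * cr q (cr p (an h' v)) B))"
    unfolding sum_distrib_left
    by (subst sum.swap[of _ ?F], subst sum.swap) (simp add: mult.left_commute sum.swap[of _ ?F])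
  also have "\<dots> = Y c h (X c v) B"
    unfolding Y_def
  proof (intro sum.cong refl arg_cong2[where f = "(*)"])
    fix q assume q: "q \<in> ?G"
    have "cr q (X c v) B = cr q (\<lambda>C. \<Sum>p\<in>?G. \<Sum>h'\<in>?F. c p h' * cr p (an h' v) C) B"
      by (rule cr_cong, subst X_eq_sum[of ?G ?F])
        (use q G in \<open>auto simp: parts_tog_part holes_tog_part\<close>)
    also have "\<dots> = (\<Sum>p\<in>?G. \<Sum>h'\<in>?F. c p h' * cr q (cr p (an h' v)) B)"
      by (rule cr_sum_sum)
    finally show "(\<Sum>p\<in>?G. \<Sum>h'\<in>?F. c p h' * cr q (cr p (an h' v)) B) = cr q (X c v) B" ..
  qed
  finally show ?thesis .
qed

lemma X_scale: "X c (\<lambda>B. a * v B) B = a * X c v B"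
  by (auto simp: X_def cr_def an_def sum_distrib_left mult.left_commute intro!: sum.cong)

lemma cr_vac: "h \<notin> P \<Longrightarrow> cr h (ket vac0) B = 0"
  using occ_vac occ_tog_iff[of h h B] by (auto simp: cr_def ket_def)

text \<open>\<open>cr h\<close> kills the vacuum and its commutator with \<open>X c\<close> commutes
  with \<open>X c\<close>, so it acts on powers like a derivation.\<close>

lemma cr_X_pow:
  assumes h: "h \<notin> P"
  shows "cr h ((X c ^^ Suc k) (ket vac0)) B = - (of_nat (Suc k) * Y c h ((X c ^^ k) (ket vac0)) B)"
proof (induction k arbitrary: B)
  case 0
  have "cr h (ket vac0) = (\<lambda>_. 0)"
    using cr_vac[OF h] by auto
  moreover have "X c (\<lambda>_. 0) B = 0"
    by (auto simp: X_def cr_def an_def intro!: sum.neutral)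
  ultimately have "X c (cr h (ket vac0)) B = 0"
    by simp
  then show ?case by (simp add: cr_X[OF h])
next
  case (Suc k)
  let ?w = "(X c ^^ k) (ket vac0)"
  have "cr h ((X c ^^ Suc k) (ket vac0)) = (\<lambda>B. - of_nat (Suc k) * Y c h ?w B)"
    by (simp only: fun_eq_iff Suc mult_minus_left) simp
  then have "X c (cr h ((X c ^^ Suc k) (ket vac0))) B = - of_nat (Suc k) * X c (Y c h ?w) B"
    by (simp only: X_scale)
  also have "\<dots> = - of_nat (Suc k) * Y c h (X c ?w) B"
    by (simp only: X_Y[OF h])
  finally have *: "X c (cr h ((X c ^^ Suc k) (ket vac0))) B
      = - of_nat (Suc k) * Y c h ((X c ^^ Suc k) (ket vac0)) B"
    by simp
  have "cr h ((X c ^^ Suc (Suc k)) (ket vac0)) B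
      = X c (cr h ((X c ^^ Suc k) (ket vac0))) B - Y c h ((X c ^^ Suc k) (ket vac0)) B"
    using cr_X[OF h] by simp
  then show ?case
    unfolding * by (simp only: of_nat_Suc) (simp add: algebra_simps)
qed

section \<open>Annihilation equations and uniqueness\<close>

text \<open>Each application of \<open>X c\<close> creates one particle and one hole.\<close>

lemma X_pow_nonzeroD:
  "(X c ^^ k) (ket vac0) B \<noteq> 0 \<Longrightarrow> card (parts B) = k \<and> card (holes B) = k"
proof (induction k arbitrary: B)
  case 0
  then have "B = vac0" by (auto simp: ket_def split: if_splits)
  then show ?case by (simp add: parts_def holes_def occ_vac)
next
  case (Suc k)
  let ?w = "(X c ^^ k) (ket vac0)"
  from Suc.prems obtain p h where ph: "p \<in> parts B" "h \<in> holes B" "c p h * cr p (an h ?w) B \<noteq> 0"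
    unfolding funpow.simps comp_def X_def by (metis (no_types, lifting) sum.not_neutral_contains_not_neutral)
  then have "?w (tog h (tog p B)) \<noteq> 0"
    by (auto simp: cr_def an_def split: if_splits)
  note IH = Suc.IH[OF this]
  have PH: "p \<in> P" "h \<notin> P" using ph by (auto simp: parts_def holes_def)
  then have "h \<in> holes (tog p B)" using ph by (simp add: holes_tog_part)
  then have "card (parts B - {p}) = k" "card (holes B - {h}) = k"
    using IH ph PH by (simp_all add: parts_tog_hole parts_tog_part holes_tog_hole holes_tog_part)
  then show ?case using ph by (metis card_Suc_Diff1 finite_holes finite_parts)
qed

lemma bog_balanced: "bog c B \<noteq> 0 \<Longrightarrow> card (parts B) = card (holes B)"
  unfolding bog_def using X_pow_nonzeroD by (metis scaleQ_zero_right)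

lemma bog_vac: "bog c vac0 = 1"
  by (simp add: bog_def parts_def occ_vac scaleQ_one ket_def)

text \<open>In \<open>cr_X_pow\<close> the factor \<open>Suc k\<close> cancels against the
  factorial. The outcome is that \<open>cr h\<close> plus the sum of \<open>c p h\<close> times
  \<open>cr p\<close> kills the exponential.\<close>

lemma cr_bog:
  assumes h: "h \<notin> P"
  shows "cr h (bog c) B = - (\<Sum>p\<in>parts B. c p h * cr p (bog c) B)"
proof -
  let ?n = "card (parts B)"
  have 1: "cr h (bog c) B = scaleQ (1 / fact ?n) (cr h ((X c ^^ ?n) (ket vac0)) B)"
    by (simp add: cr_def bog_def parts_tog_hole[OF h] mult_scaleQ_right)
  show ?thesis
  proof (cases ?n)
    case 0
    then have "parts B = {}" by simp
    then show ?thesis by (simp add: 1 cr_vac[OF h])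
  next
    case (Suc k)
    have "cr h (bog c) B = - scaleQ (1 / fact k) (Y c h ((X c ^^ k) (ket vac0)) B)"
      unfolding 1 Suc cr_X_pow[OF h] scaleQ_minus_right scaleQ_fact_Suc ..
    also have "scaleQ (1 / fact k) (Y c h ((X c ^^ k) (ket vac0)) B)
        = (\<Sum>p\<in>parts B. c p h * cr p (bog c) B)"
      unfolding Y_def scaleQ_sum
    proof (intro sum.cong refl)
      fix p assume p: "p \<in> parts B"
      \<comment> \<open>With the particle \<open>p\<close> removed, \<open>bog c\<close> at
        \<open>tog p B\<close> uses exactly the power \<open>k\<close>.\<close>
      have "card (parts (tog p B)) = k"
        using p Suc by (simp add: parts_tog_part)
      then show "scaleQ (1 / fact k) (c p h * cr p ((X c ^^ k) (ket vac0)) B) = c p h * cr p (bog c) B"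
        by (simp add: cr_def bog_def mult_scaleQ_right)
    qed
    finally show ?thesis .
  qed
qed

text \<open>The equations express a coefficient through coefficients with one hole fewer. Induction
  on the number of holes leaves the states without holes, where only the vacuum may carry a nonzero
  value.\<close>

lemma eq_by_holes:
  assumes v: "\<And>h B. h \<notin> P \<Longrightarrow> h \<in> occ B \<Longrightarrow> cr h v B = - (\<Sum>p\<in>parts B. c p h * cr p v B)"
    and w: "\<And>h B. h \<notin> P \<Longrightarrow> h \<in> occ B \<Longrightarrow> cr h w B = - (\<Sum>p\<in>parts B. c p h * cr p w B)"
    and v0: "\<And>B. holes B = {} \<Longrightarrow> parts B \<noteq> {} \<Longrightarrow> v B = 0"
    and w0: "\<And>B. holes B = {} \<Longrightarrow> parts B \<noteq> {} \<Longrightarrow> w B = 0"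
    and vac: "v vac0 = w vac0"
  shows "v B = w B"
proof (induction "card (holes B)" arbitrary: B)
  case 0
  then have h: "holes B = {}" by simp
  show ?case
  proof (cases "parts B = {}")
    case True
    then have "occ B = occ vac0" using h by (auto simp: parts_def holes_def occ_vac)
    then have "B = vac0" by (rule inj_occ)
    then show ?thesis using vac by simp
  qed (simp add: v0 w0 h)
next
  case (Suc k)
  then obtain h where h: "h \<in> holes B"
    by (metis card.empty ex_in_conv nat.distinct(1))
  \<comment> \<open>With the hole filled, the left side of the equation for \<open>h\<close> at
    \<open>?C\<close> reads the coefficient at \<open>B\<close>, up to a sign.\<close>
  let ?C = "tog h B"
  have hC: "h \<notin> P" "h \<in> occ ?C" using h by (auto simp: holes_def occ_tog_iff)
  have "v (tog p ?C) = w (tog p ?C)" if "p \<in> parts ?C" for p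
  proof (rule Suc.hyps(1))
    have "p \<in> P" using that by (simp add: parts_def)
    then show "k = card (holes (tog p ?C))"
      using Suc.hyps(2) h by (simp add: holes_tog_part holes_tog_hole)
  qed
  then have "cr h v ?C = cr h w ?C"
    unfolding v[OF hC] w[OF hC]
    by (intro arg_cong[where f = uminus] sum.cong refl arg_cong2[where f = "(*)"] cr_cong) auto
  then have "sg h ?C * v B = sg h ?C * w B"
    using hC by (simp add: cr_def)
  then have "(sg h ?C * sg h ?C) * v B = (sg h ?C * sg h ?C) * w B"
    by (simp add: mult.assoc)
  then show ?case by (simp add: sg_sq)
qed

section \<open>Particle-hole duality and the exponential series\<close>

lemma dual_fermions: "fermions (\<lambda>B. - occ B) tog sg (- P) vac0"
proof
  show "r \<noteq> s \<Longrightarrow> sg r B * sg s (tog r B) = - (sg s B * sg r (tog s B))" for r s B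
    by (rule sg_anti)
  show "finite (- occ B \<inter> - P)" for B
    using finite_compl_occ[of B] by (simp add: Diff_eq Int_commute)
  show "finite (- (- P) - - occ B)" for B
    using finite_occ_Int[of B] by (simp add: Diff_eq Int_commute)
qed (auto simp: occ_tog sg_sq sg_tog occ_vac dest: inj_occ)

text \<open>This is \<open>cr_bog\<close> after exchanging occupied and empty modes. The exchange
  swaps \<open>cr\<close> with \<open>an\<close>; anticommuting the two factors of each term shows
  that the coefficient matrix is transposed and negated.\<close>

lemma an_bog:
  assumes p: "p \<in> P"
  shows "an p (bog c) B = (\<Sum>h\<in>holes B. c p h * an h (bog c) B)"
proof -
  interpret dual: fermions "\<lambda>B. - occ B" tog sg "- P" vac0
    by (rule dual_fermions)
  let ?c = "\<lambda>h p. - c p h"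
  have cr: "dual.cr = an" by (simp add: fun_eq_iff dual.cr_def an_def)
  have an: "dual.an = cr" by (simp add: fun_eq_iff dual.an_def cr_def)
  have parts: "dual.parts = holes" by (auto simp: fun_eq_iff dual.parts_def holes_def)
  have holes: "dual.holes = parts" by (auto simp: fun_eq_iff dual.holes_def parts_def)
  have "dual.X ?c = X c"
  proof (intro ext)
    fix v B
    have "dual.X ?c v B = (\<Sum>h\<in>holes B. \<Sum>p\<in>parts B. - c p h * an h (cr p v) B)"
      by (simp add: dual.X_def cr an parts holes)
    also have "\<dots> = (\<Sum>h\<in>holes B. \<Sum>p\<in>parts B. c p h * cr p (an h v) B)"
      by (intro sum.cong refl, subst cr_an) (auto simp: holes_def parts_def)
    also have "\<dots> = X c v B"
      unfolding X_def by (rule sum.swap)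
    finally show "dual.X ?c v B = X c v B" .
  qed
  \<comment> \<open>The dual exponent counts holes instead of particles. If the two numbers differ,
    every power vanishes at \<open>B\<close>.\<close>
  then have "dual.bog ?c B = bog c B" for B
    using X_pow_nonzeroD[of _ c B] unfolding dual.bog_def bog_def parts
    by (metis scaleQ_zero_right)
  then have bog: "dual.bog ?c = bog c" by auto
  show ?thesis
    using dual.cr_bog[of p ?c B] p by (simp add: bog cr parts sum_negf)
qed

lemma op_exp_X: "op_exp (X c) (ket vac0) = bog c"
proof
  fix B
  have "scaleQ (1 / fact k) ((X c ^^ k) (ket vac0) B) = 0" if "k \<notin> {card (parts B)}" for k
    using X_pow_nonzeroD[of k c B] that by (metis insertI1 scaleQ_zero_right)
  then show "op_exp (X c) (ket vac0) B = bog c B"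
    unfolding op_exp_def bog_def by (subst Sum_any_eq_sum[where S = "{card (parts B)}"]) auto
qed

lemma cr_an_nonzeroD:
  assumes "cr p (an h v) B \<noteq> 0" "p \<in> P" "h \<notin> P"
  shows "p \<in> parts B" "h \<in> holes B"
  using assms by (auto simp: cr_def an_def parts_def holes_def occ_tog_iff split: if_splits)

end

section \<open>Occupation signs and the one- and two-component mode systems\<close>

definition flip :: "int \<Rightarrow> adm \<Rightarrow> adm" where
  "flip r A = Adm (if r \<in> modes A then modes A - {r} else insert r (modes A))"

definition sgn1 :: "int \<Rightarrow> adm \<Rightarrow> 'k::comm_ring_1" where
  "sgn1 r A = (- 1) ^ card {a \<in> modes A. r < a}"

definition koszul :: "adm \<Rightarrow> 'k::comm_ring_1" where
  "koszul A = (if even (charge A) then 1 else - 1)"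

lemma modes_flip: "modes (flip r A) = (if r \<in> modes A then modes A - {r} else insert r (modes A))"
  by (simp add: flip_def)

lemma flip_flip [simp]: "flip r (flip r A) = A"
proof -
  have "modes (flip r (flip r A)) = modes A" by (auto simp: modes_flip)
  then show ?thesis by (simp add: modes_inject)
qed

lemma finite_particles_modes: "finite (modes A \<inter> {0..})"
  using modes[of A] by (auto elim!: rev_finite_subset)

lemma finite_holes_modes: "finite ({..<0} - modes A)"
  using modes[of A] by auto

lemma finite_greater_modes: "finite {a \<in> modes A. r < a}"
  by (rule finite_subset[of _ "(modes A \<inter> {0..}) \<union> {r..0}"]) (auto simp: finite_particles_modes)

lemma sgn1_square: "sgn1 r A * sgn1 r A = 1"
  by (simp add: sgn1_def flip: power_mult_distrib)

text \<open>Toggling \<open>s\<close> changes the number of occupied modes above \<open>r\<close> by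
  one if \<open>r < s\<close> and not at all otherwise. For distinct modes exactly one of
  \<open>r < s\<close> and \<open>s < r\<close> holds, whence the anticommutation
  \<open>sg_anti\<close>.\<close>

lemma sgn1_flip: "sgn1 r (flip s A) = (if r < s then - sgn1 r A else sgn1 r A)"
proof (cases "r < s")
  case False
  then have "{a \<in> modes (flip s A). r < a} = {a \<in> modes A. r < a}"
    by (auto simp: modes_flip)
  then show ?thesis using False by (simp add: sgn1_def)
next
  case True
  let ?S = "{a \<in> modes A. r < a}"
  show ?thesis
  proof (cases "s \<in> modes A")
    case s: True
    then have "{a \<in> modes (flip s A). r < a} = ?S - {s}" by (auto simp: modes_flip)
    moreover have "card ?S = Suc (card (?S - {s}))"
      using s True finite_greater_modes by (intro card.remove) auto
    ultimately show ?thesis using True by (simp add: sgn1_def)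
  next
    case s: False
    then have "{a \<in> modes (flip s A). r < a} = insert s ?S" using True by (auto simp: modes_flip)
    then show ?thesis using True s finite_greater_modes by (simp add: sgn1_def)
  qed
qed

text \<open>A toggle changes the number of particles or the number of holes by one, never both. This
  is the source of the sign between the two components.\<close>

lemma even_charge_flip: "even (charge (flip r A)) \<longleftrightarrow> odd (charge A)"
proof -
  let ?p = "\<lambda>A. modes A - {..<0}" and ?h = "\<lambda>A. {..<0} - modes A"
  have fin: "finite (?p A)" "finite (?h A)" using modes[of A] by auto
  consider "r \<ge> 0" "r \<in> modes A" | "r \<ge> 0" "r \<notin> modes A" | "r < 0" "r \<in> modes A"
    | "r < 0" "r \<notin> modes A" by linarith
  then have "charge (flip r A) = charge A - 1 \<or> charge (flip r A) = charge A + 1"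
  proof cases
    case 1
    then have "?h (flip r A) = ?h A" "?p (flip r A) = ?p A - {r}" by (auto simp: modes_flip)
    moreover have "card (?p A) = Suc (card (?p A - {r}))"
      using 1 fin by (intro card.remove) auto
    ultimately show ?thesis by (simp add: charge_def)
  next
    case 2
    then have "?h (flip r A) = ?h A" "?p (flip r A) = insert r (?p A)" by (auto simp: modes_flip)
    then show ?thesis using 2 fin by (simp add: charge_def)
  next
    case 3
    then have "?p (flip r A) = ?p A" "?h (flip r A) = insert r (?h A)" by (auto simp: modes_flip)
    then show ?thesis using 3 fin by (simp add: charge_def)
  next
    case 4
    then have "?p (flip r A) = ?p A" "?h (flip r A) = ?h A - {r}" by (auto simp: modes_flip)
    moreover have "card (?h A) = Suc (card (?h A - {r}))"
      using 4 fin by (intro card.remove) auto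
    ultimately show ?thesis by (simp add: charge_def)
  qed
  then show ?thesis by auto
qed

lemma koszul_flip: "koszul (flip r A) = - koszul A"
  by (simp add: koszul_def even_charge_flip)

lemma koszul_square: "koszul A * koszul A = 1"
  by (simp add: koszul_def)

global_interpretation one: fermions modes flip "sgn1 :: int \<Rightarrow> adm \<Rightarrow> 'k::comm_rat_algebra_1" "{0..}" vac
proof
  show "A = B" if "modes A = modes B" for A B
    using that by (simp add: modes_inject)
  show "modes (flip r B) = (if r \<in> modes B then modes B - {r} else insert r (modes B))" for r B
    by (rule modes_flip)
  show "finite (- {0..} - modes B)" for B
    by (rule finite_subset[OF _ finite_holes_modes[of B]]) auto
  show "finite (modes B \<inter> {0..})" for B
    by (rule finite_particles_modes)
qed (auto simp: sgn1_flip sgn1_square)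

definition occ2 :: "adm \<times> adm \<Rightarrow> (int + int) set" where
  "occ2 = (\<lambda>(A, B). modes A <+> modes B)"

definition flip2 :: "int + int \<Rightarrow> adm \<times> adm \<Rightarrow> adm \<times> adm" where
  "flip2 x = (\<lambda>(A, B). case x of Inl r \<Rightarrow> (flip r A, B) | Inr r \<Rightarrow> (A, flip r B))"

definition sgn2 :: "int + int \<Rightarrow> adm \<times> adm \<Rightarrow> 'k::comm_ring_1" where
  "sgn2 x = (\<lambda>(A, B). case x of Inl r \<Rightarrow> sgn1 r A | Inr r \<Rightarrow> koszul A * sgn1 r B)"

lemma koszul_sgn1_square: "koszul A * sgn1 r B * (koszul A * sgn1 r B) = 1"
  by (simp add: sgn1_square koszul_square mult.assoc mult.left_commute[of "sgn1 r B"])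

lemma Inl_in_Plus_iff [simp]: "Inl a \<in> A <+> B \<longleftrightarrow> a \<in> A"
  by auto

lemma Inr_in_Plus_iff [simp]: "Inr b \<in> A <+> B \<longleftrightarrow> b \<in> B"
  by auto

lemma Compl_Plus: "- (A <+> B) = - A <+> - B"
proof (rule set_eqI)
  show "x \<in> - (A <+> B) \<longleftrightarrow> x \<in> - A <+> - B" for x
    by (cases x) simp_all
qed

lemma Plus_Int_Plus: "(A <+> B) \<inter> (C <+> D) = (A \<inter> C) <+> (B \<inter> D)"
  by auto

lemma Compl_atLeast_int: "- {0 :: int..} = {..<0}"
  by auto

text \<open>Between different components the anticommutation comes from \<open>koszul_flip\<close>
  alone: a toggle in the first component negates the signs of the second, while a toggle in the
  second leaves those of the first unchanged.\<close>

global_interpretation two: fermions occ2 flip2 "sgn2 :: int + int \<Rightarrow> adm \<times> adm \<Rightarrow> 'k::comm_rat_algebra_1"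
  "{0..} <+> {0..}" "(vac, vac)"
proof
  show "X = Y" if "occ2 X = occ2 Y" for X Y
  proof -
    obtain A B C D where XY: "X = (A, B)" "Y = (C, D)" by (cases X, cases Y)
    have "modes A = Inl -` occ2 X" "modes B = Inr -` occ2 X"
      "modes C = Inl -` occ2 Y" "modes D = Inr -` occ2 Y"
      by (auto simp: occ2_def XY)
    then have "modes A = modes C" "modes B = modes D" using that by metis+
    then show ?thesis using XY by (simp add: modes_inject)
  qed
  show "occ2 (flip2 x X) = (if x \<in> occ2 X then occ2 X - {x} else insert x (occ2 X))" for x X
    by (cases X; cases x) (auto simp: occ2_def flip2_def modes_flip)
  show "sgn2 x X * sgn2 x X = 1" for x X
    by (cases X; cases x) (auto simp: sgn2_def sgn1_square koszul_sgn1_square)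
  show "sgn2 x (flip2 x X) = sgn2 x X" for x X
    by (cases X; cases x) (auto simp: sgn2_def flip2_def sgn1_flip)
  show "sgn2 x X * sgn2 y (flip2 x X) = - (sgn2 y X * sgn2 x (flip2 y X))" if "x \<noteq> y" for x y X
    using that by (cases X; cases x; cases y) (auto simp: sgn2_def flip2_def sgn1_flip koszul_flip)
  show "finite (occ2 X \<inter> ({0..} <+> {0..}))" for X
    by (cases X) (simp add: occ2_def Plus_Int_Plus finite_Plus finite_particles_modes)
  show "finite (- ({0..} <+> {0..}) - occ2 X)" for X
    by (cases X) (simp add: occ2_def Diff_eq Plus_Int_Plus Compl_Plus finite_Plus Compl_atLeast_int
        finite_holes_modes[unfolded Diff_eq])
  show "occ2 (vac, vac) = - ({0..} <+> {0..})"
    by (simp add: occ2_def Compl_Plus Compl_atLeast_int)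
qed

lemma two_cr_Inl:
  "two.cr (Inl r) v (A, B) = (if r \<in> modes A then sgn1 r A * v (flip r A, B) else 0)"
  by (subst two.cr_def) (auto simp: occ2_def flip2_def sgn2_def)

lemma two_cr_Inr:
  "two.cr (Inr r) v (A, B) = (if r \<in> modes B then koszul A * sgn1 r B * v (A, flip r B) else 0)"
  by (subst two.cr_def) (auto simp: occ2_def flip2_def sgn2_def)

lemma two_an_Inl:
  "two.an (Inl r) v (A, B) = (if r \<in> modes A then 0 else sgn1 r A * v (flip r A, B))"
  by (subst two.an_def) (auto simp: occ2_def flip2_def sgn2_def)

lemma two_an_Inr:
  "two.an (Inr r) v (A, B) = (if r \<in> modes B then 0 else koszul A * sgn1 r B * v (A, flip r B))"
  by (subst two.an_def) (auto simp: occ2_def flip2_def sgn2_def)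

section \<open>The fermion operators in terms of abstract modes\<close>

lemma ket_flip: "ket (flip r A) B = (if A = flip r B then 1 else 0)"
  by (auto simp: ket_def)

lemma ket_same [simp]: "ket A A = 1"
  by (simp add: ket_def)

text \<open>For a fixed target \<open>B\<close> the only possible source is \<open>flip r B\<close>,
  so the linear extension reduces to a single term.\<close>

lemma psi_ket_eq:
  "psi_ket r A B = (if A = flip r B then if r \<in> modes B then sgn1 r B else 0 else 0)"
proof -
  have "psi_ket r A B = (if r \<in> modes A then 0 else sgn1 r A * ket (flip r A) B)"
    by (simp add: psi_ket_def sgn1_def flip_def)
  then show ?thesis by (auto simp: ket_flip sgn1_flip modes_flip)
qed

lemma psi_star_ket_eq:
  "psi_star_ket r A B = (if A = flip r B then if r \<in> modes B then 0 else sgn1 r B else 0)"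
proof -
  \<comment> \<open>The position of \<open>r\<close> counts \<open>r\<close> itself, so the exponent
    exceeds that of \<open>sgn1\<close> by two and the signs agree.\<close>
  have "{a \<in> modes A. r \<le> a} = insert r {a \<in> modes A. r < a}" if "r \<in> modes A"
    using that by auto
  then have "psi_star_ket r A B = (if r \<in> modes A then sgn1 r A * ket (flip r A) B else 0)"
    using finite_greater_modes[of A r] by (simp add: psi_star_ket_def sgn1_def flip_def)
  then show ?thesis by (auto simp: ket_flip sgn1_flip modes_flip)
qed

lemma lin_ext_single:
  assumes "\<And>A. T A B = (if A = C then t else 0)"
  shows "lin_ext T v B = v C * t"
  unfolding lin_ext_def
  by (subst Sum_any_eq_sum[where S = "{C}"]) (auto simp: assms)

lemma psi_eq: "psi r = one.cr r"
proof (intro ext)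
  fix v B
  show "psi r v B = one.cr r v B"
    unfolding psi_def by (subst lin_ext_single[OF psi_ket_eq]) (simp add: one.cr_def)
qed

lemma psi_star_eq: "psi_star r = one.an r"
proof (intro ext)
  fix v B
  show "psi_star r v B = one.an r v B"
    unfolding psi_star_def by (subst lin_ext_single[OF psi_star_ket_eq]) (simp add: one.an_def)
qed

lemma on_fst_single:
  assumes "\<And>A. T A A' = (if A = C then t else 0)"
  shows "on_fst T X (A', B') = (if X = (C, B') then t else 0)"
  by (cases X) (auto simp: on_fst_def ket_def assms)

lemma on_snd_single:
  assumes "\<And>B. T B B' = (if B = C then t else 0)"
  shows "on_snd T X (A', B') = (if X = (A', C) then koszul A' * t else 0)"
  by (cases X) (auto simp: on_snd_def ket_def assms koszul_def)

lemma psi12_1_eq: "psi12 (Suc 0) r = two.cr (Inl r)"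
proof (intro ext)
  fix v and X :: "adm \<times> adm"
  obtain A B where X: "X = (A, B)" by (cases X)
  show "psi12 (Suc 0) r v X = two.cr (Inl r) v X"
    unfolding psi12_def X
    by (simp, subst lin_ext_single[where T = "on_fst (psi_ket r)" and B = "(A, B)", OF on_fst_single[where T = "psi_ket r", OF psi_ket_eq]])
      (simp add: two_cr_Inl two_cr_Inr)
qed

lemma psi_star12_1_eq: "psi_star12 (Suc 0) r = two.an (Inl r)"
proof (intro ext)
  fix v and X :: "adm \<times> adm"
  obtain A B where X: "X = (A, B)" by (cases X)
  show "psi_star12 (Suc 0) r v X = two.an (Inl r) v X"
    unfolding psi_star12_def X
    by (simp, subst lin_ext_single[where T = "on_fst (psi_star_ket r)" and B = "(A, B)", OF on_fst_single[where T = "psi_star_ket r", OF psi_star_ket_eq]])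
      (simp add: two_an_Inl two_an_Inr)
qed

lemma psi12_2_eq: "psi12 2 r = two.cr (Inr r)"
proof (intro ext)
  fix v and X :: "adm \<times> adm"
  obtain A B where X: "X = (A, B)" by (cases X)
  show "psi12 2 r v X = two.cr (Inr r) v X"
    unfolding psi12_def X
    by (simp, subst lin_ext_single[where T = "on_snd (psi_ket r)" and B = "(A, B)", OF on_snd_single[where T = "psi_ket r", OF psi_ket_eq]])
      (simp add: two_cr_Inl two_cr_Inr)
qed

lemma psi_star12_2_eq: "psi_star12 2 r = two.an (Inr r)"
proof (intro ext)
  fix v and X :: "adm \<times> adm"
  obtain A B where X: "X = (A, B)" by (cases X)
  show "psi_star12 2 r v X = two.an (Inr r) v X"
    unfolding psi_star12_def X
    by (simp, subst lin_ext_single[where T = "on_snd (psi_star_ket r)" and B = "(A, B)", OF on_snd_single[where T = "psi_star_ket r", OF psi_star_ket_eq]])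
      (simp add: two_an_Inl two_an_Inr)
qed

section \<open>Quadratic operators and Bogoliubov transforms in terms of abstract modes\<close>

text \<open>This recovers the natural index from a mode: \<open>m\<close> from the particle mode
  \<open>int m\<close> and \<open>n\<close> from the hole mode \<open>- int n - 1\<close>.\<close>

definition label :: "int \<Rightarrow> nat" where
  "label r = (if r < 0 then nat (- r - 1) else nat r)"

lemma label_int [simp]: "label (int m) = m"
  by (simp add: label_def)

lemma label_hole [simp]: "label (- int n - 1) = n"
  by (simp add: label_def)

lemma Sum_any_modes:
  assumes "finite G" "G \<subseteq> {0..}" "finite F" "F \<subseteq> {..<0}"
    and "\<And>m n. f m n \<noteq> 0 \<Longrightarrow> int m \<in> G \<and> - int n - 1 \<in> F"
  shows "Sum_any (\<lambda>(m, n). f m n) = (\<Sum>p\<in>G. \<Sum>h\<in>F. f (label p) (label h))"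
proof -
  have G: "int (label p) = p" if "p \<in> G" for p
    using that assms(2) by (auto simp: label_def)
  have F: "- int (label h) - 1 = h" if "h \<in> F" for h
    using that assms(4) by (auto simp: label_def)
  have "Sum_any (\<lambda>(m, n). f m n) = (\<Sum>(m, n)\<in>label ` G \<times> label ` F. f m n)"
  proof (rule Sum_any_eq_sum)
    fix x assume x: "x \<notin> label ` G \<times> label ` F"
    obtain m n where mn: "x = (m, n)" by (cases x)
    have "f m n = 0"
    proof (rule ccontr)
      assume "f m n \<noteq> 0"
      from assms(5)[OF this] have "m \<in> label ` G" "n \<in> label ` F"
        by (metis imageI label_int, metis imageI label_hole)
      with x mn show False by simp
    qed
    then show "(case x of (m, n) \<Rightarrow> f m n) = 0" by (simp add: mn)
  qed (use assms in simp)
  also have "\<dots> = (\<Sum>m\<in>label ` G. \<Sum>n\<in>label ` F. f m n)"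
    by (simp add: sum.cartesian_product)
  also have "\<dots> = (\<Sum>p\<in>G. \<Sum>h\<in>F. f (label p) (label h))"
  proof -
    have "inj_on label G" "inj_on label F" using G F by (metis inj_onI)+
    then show ?thesis by (simp add: sum.reindex)
  qed
  finally show ?thesis .
qed

lemma one_parts: "one.parts B = modes B \<inter> {0..}"
  by (simp add: one.parts_def)

lemma one_holes: "one.holes B = {..<0} - modes B"
  by (simp add: one.holes_def Compl_atLeast_int)

lemma int_label: "0 \<le> p \<Longrightarrow> int (label p) = p"
  by (simp add: label_def)

lemma hole_label: "h < 0 \<Longrightarrow> - int (label h) - 1 = h"
  by (simp add: label_def)

lemma quad_eq: "quad c = one.X (\<lambda>p h. c (label p) (label h))"
proof (intro ext)
  fix v B
  have "quad c v B = (\<Sum>p\<in>one.parts B. \<Sum>h\<in>one.holes B.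
      c (label p) (label h) * one.cr (int (label p)) (one.an (- int (label h) - 1) v) B)"
    unfolding quad_def psi_eq psi_star_eq
  proof (rule Sum_any_modes)
    fix m n assume "c m n * one.cr (int m) (one.an (- int n - 1) v) B \<noteq> 0"
    then have "one.cr (int m) (one.an (- int n - 1) v) B \<noteq> 0" by auto
    from one.cr_an_nonzeroD[OF this]
    show "int m \<in> one.parts B \<and> - int n - 1 \<in> one.holes B" by simp
  qed (auto simp: one_parts one_holes finite_particles_modes finite_holes_modes)
  also have "\<dots> = one.X (\<lambda>p h. c (label p) (label h)) v B"
    unfolding one.X_def
    by (intro sum.cong refl) (auto simp: one_parts one_holes int_label hole_label)
  finally show "quad c v B = one.X (\<lambda>p h. c (label p) (label h)) v B" .
qed

lemma bogoliubov_eq: "bogoliubov c = one.bog (\<lambda>p h. c (label p) (label h))"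
  by (simp add: bogoliubov_def quad_eq one.op_exp_X)

definition component :: "int + int \<Rightarrow> nat" where
  "component x = (case x of Inl _ \<Rightarrow> 1 | Inr _ \<Rightarrow> 2)"

definition label2 :: "int + int \<Rightarrow> nat" where
  "label2 x = (case x of Inl r \<Rightarrow> label r | Inr r \<Rightarrow> label r)"

lemma two_parts: "two.parts (A, B) = one.parts A <+> one.parts B"
  by (subst two.parts_def) (simp add: occ2_def Plus_Int_Plus one_parts)

lemma two_holes: "two.holes (A, B) = one.holes A <+> one.holes B"
  by (subst two.holes_def) (simp add: occ2_def Plus_Int_Plus one_holes Compl_Plus Diff_eq Compl_atLeast_int)

lemma quad12_eq:
  fixes c :: "nat \<Rightarrow> nat \<Rightarrow> nat \<Rightarrow> nat \<Rightarrow> 'k::comm_rat_algebra_1"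
  shows "quad12 c = two.X (\<lambda>x y. c (component x) (component y) (label2 x) (label2 y))"
proof (intro ext)
  fix v :: "adm \<times> adm \<Rightarrow> 'k" and Z :: "adm \<times> adm"
  obtain A B where Z: "Z = (A, B)" by (cases Z)
  \<comment> \<open>\<open>I\<close> and \<open>J\<close> choose the components of the created and
    the removed mode, so one statement covers all four blocks of the coefficient matrix.\<close>
  have *: "Sum_any (\<lambda>(m, n). a m n * two.cr (I (int m)) (two.an (J (- int n - 1)) v) (A, B))
      = (\<Sum>p\<in>one.parts A'. \<Sum>h\<in>one.holes B'.
          a (label p) (label h) * two.cr (I p) (two.an (J h) v) (A, B))"
    if IA: "(I = Inl \<and> A' = A) \<or> (I = Inr \<and> A' = B)"
      and JB: "(J = Inl \<and> B' = A) \<or> (J = Inr \<and> B' = B)"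
    for a I J A' B'
  proof -
    have "Sum_any (\<lambda>(m, n). a m n * two.cr (I (int m)) (two.an (J (- int n - 1)) v) (A, B))
      = (\<Sum>p\<in>one.parts A'. \<Sum>h\<in>one.holes B'. a (label p) (label h) *
          two.cr (I (int (label p))) (two.an (J (- int (label h) - 1)) v) (A, B))"
    proof (rule Sum_any_modes)
      fix m n assume "a m n * two.cr (I (int m)) (two.an (J (- int n - 1)) v) (A, B) \<noteq> 0"
      then have "two.cr (I (int m)) (two.an (J (- int n - 1)) v) (A, B) \<noteq> 0" by auto
      from two.cr_an_nonzeroD[OF this]
      show "int m \<in> one.parts A' \<and> - int n - 1 \<in> one.holes B'"
        using IA JB by (auto simp: two_parts two_holes)
    qed (auto simp: one_parts one_holes finite_particles_modes finite_holes_modes)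
    also have "\<dots> = (\<Sum>p\<in>one.parts A'. \<Sum>h\<in>one.holes B'.
        a (label p) (label h) * two.cr (I p) (two.an (J h) v) (A, B))"
      by (intro sum.cong refl) (auto simp: one_parts one_holes int_label hole_label)
    finally show ?thesis .
  qed
  show "quad12 c v Z = two.X (\<lambda>x y. c (component x) (component y) (label2 x) (label2 y)) v Z"
    unfolding Z two.X_def two_parts two_holes quad12_def
    by (simp add: psi12_1_eq psi12_2_eq psi_star12_1_eq psi_star12_2_eq sum.Plus
        *[of Inl A Inl A] *[of Inl A Inr B] *[of Inr B Inl A] *[of Inr B Inr B] component_def
        label2_def one.finite_parts one.finite_holes sum.distrib finite_Plus algebra_simps)
qed

lemma bogoliubov12_eq:
  "bogoliubov12 c = two.bog (\<lambda>x y. c (component x) (component y) (label2 x) (label2 y))"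
  by (simp add: bogoliubov12_def quad12_eq two.op_exp_X)

section \<open>Pairing with the second vector\<close>

text \<open>
  The coefficient of \<open>Q ^ N\<close> in the vector to be paired with is supported in \<open>window M\<close> for every
  \<open>M \<ge> N\<close>; the freedom in \<open>M\<close> makes the window stable under toggling any given mode.
\<close>

definition window :: "nat \<Rightarrow> adm set" where
  "window M = {B. modes B \<subseteq> {..<int M} \<and> {..< - int M} \<subseteq> modes B}"

lemma finite_window [simp]: "finite (window M)"
proof (rule finite_subset)
  show "window M \<subseteq> (\<lambda>S. Adm ({..< - int M} \<union> S)) ` Pow {- int M..<int M}"
  proof
    fix B assume B: "B \<in> window M"
    then have "{..< - int M} \<union> (modes B - {..< - int M}) = modes B"
      by (auto simp: window_def)
    then have "B = Adm ({..< - int M} \<union> (modes B - {..< - int M}))"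
      by (simp add: modes_inverse)
    moreover have "modes B - {..< - int M} \<in> Pow {- int M..<int M}"
      using B by (auto simp: window_def)
    ultimately show "B \<in> (\<lambda>S. Adm ({..< - int M} \<union> S)) ` Pow {- int M..<int M}" by blast
  qed
qed simp

lemma flip_in_window: "- int M \<le> r \<Longrightarrow> r < int M \<Longrightarrow> flip r B \<in> window M \<longleftrightarrow> B \<in> window M"
  by (auto simp: window_def modes_flip)

text \<open>Adjointness of creation and annihilation: \<open>flip r\<close> is an involution of the
  window when \<open>r\<close> lies inside it, and the signs at both ends agree.\<close>

lemma sum_cr_window:
  fixes g w :: "adm \<Rightarrow> 'k::comm_rat_algebra_1"
  assumes r: "- int M \<le> r" "r < int M"
  shows "(\<Sum>B\<in>window M. one.cr r g B * w B) = (\<Sum>B\<in>window M. g B * one.an r w B)"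
  by (rule sum.reindex_bij_witness[where i = "flip r" and j = "flip r"])
    (auto simp: flip_in_window[OF r] one.cr_def one.an_def modes_flip sgn1_flip)

lemma sgn1_mult_nth: "fps_nth (sgn1 r B * f) N = sgn1 r B * fps_nth f N"
proof -
  have "(sgn1 r B :: 'a fps) = fps_const (sgn1 r B)"
    by (simp add: sgn1_def flip: fps_const_1_eq_1 fps_const_neg fps_const_power)
  then show ?thesis by simp
qed

lemma an_nth: "fps_nth (one.an r v B) N = one.an r (\<lambda>B. fps_nth (v B) N) B"
  by (simp add: one.an_def sgn1_mult_nth)

context
  fixes A :: "nat \<Rightarrow> nat \<Rightarrow> 'k::comm_rat_algebra_1"
begin

definition U :: "adm \<Rightarrow> 'k fps" where
  "U = bogoliubov (\<lambda>m n. fps_X ^ (m + n + 1) * fps_const (A m n))"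

lemma U_nth_outside: "B \<notin> window M \<Longrightarrow> N \<le> M \<Longrightarrow> fps_nth (U B) N = 0"
  using bogoliubov_nth_nonzeroD[of A B N] by (force simp: U_def window_def)

lemma inner_fock_U_nth:
  assumes "N \<le> M"
  shows "fps_nth (inner_fock g U) N = (\<Sum>B\<in>window M. g B * fps_nth (U B) N)"
  unfolding inner_fock_def
  by (simp, rule Sum_any_eq_sum) (auto simp: U_nth_outside[OF _ assms])

lemma an_U_nth:
  "fps_nth (one.an (int m) U B) N =
     (\<Sum>k<N - m. A m k * one.an (- int k - 1) (\<lambda>B. fps_nth (U B) (N - m - k - 1)) B)"
proof -
  let ?f = "\<lambda>k. A m k * one.an (- int k - 1) (\<lambda>B. fps_nth (U B) (N - m - k - 1)) B"
  let ?K = "{k. k < N - m \<and> - int k - 1 \<in> one.holes B}"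
  have "one.an (int m) U B = (\<Sum>h\<in>one.holes B.
      fps_X ^ (m + label h + 1) * (fps_const (A m (label h)) * one.an h U B))"
    using one.an_bog[of "int m" "\<lambda>p h. fps_X ^ (label p + label h + 1) * fps_const (A (label p) (label h))" B]
    by (simp add: U_def bogoliubov_eq mult.assoc)
  \<comment> \<open>The power of Q leaves only \<open>label h < N - m\<close>; for
    \<open>m \<ge> N\<close> the truncated difference is \<open>0\<close> and no term
    survives.\<close>
  then have "fps_nth (one.an (int m) U B) N
      = (\<Sum>h\<in>one.holes B. if label h < N - m then ?f (label h) else 0)"
    by (auto simp: fps_sum_nth fps_X_power_mult_nth an_nth one_holes hole_label
        simp del: power_Suc intro!: sum.cong)
  also have "\<dots> = (\<Sum>h | h \<in> one.holes B \<and> label h < N - m. ?f (label h))"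
    by (rule sum.inter_filter[symmetric]) (simp add: one.finite_holes)
  also have "{h. h \<in> one.holes B \<and> label h < N - m} = (\<lambda>k. - int k - 1) ` ?K"
  proof
    show "{h. h \<in> one.holes B \<and> label h < N - m} \<subseteq> (\<lambda>k. - int k - 1) ` ?K"
    proof
      fix h assume h: "h \<in> {h. h \<in> one.holes B \<and> label h < N - m}"
      then have "h = - int (label h) - 1" by (simp add: one_holes hole_label)
      moreover from this h have "label h \<in> ?K" by auto
      ultimately show "h \<in> (\<lambda>k. - int k - 1) ` ?K" by (rule image_eqI)
    qed
  qed auto
  also have "(\<Sum>h\<in>(\<lambda>k. - int k - 1) ` ?K. ?f (label h)) = (\<Sum>k\<in>?K. ?f k)"
    by (subst sum.reindex) (auto simp: inj_on_def)
  also have "\<dots> = (\<Sum>k<N - m. ?f k)"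
    by (rule sum.mono_neutral_left) (auto simp: one.an_def one_holes)
  finally show ?thesis .
qed

text \<open>The creation operator moves to \<open>U\<close> as its adjoint, the dual equation
  \<open>an_U_nth\<close> trades it for annihilators of negative modes, and these move back to
  \<open>g\<close>.\<close>

lemma inner_fock_cr_U_nth:
  "fps_nth (inner_fock (one.cr (int m) g) U) N =
     (\<Sum>k<N - m. A m k * fps_nth (inner_fock (one.cr (- int k - 1) g) U) (N - m - k - 1))"
proof -
  \<comment> \<open>This window contains the supports of all coefficients up to \<open>N\<close> and
    is stable under toggling \<open>int m\<close> and every \<open>- int k - 1\<close> with
    \<open>k < N - m\<close>.\<close>
  let ?M = "N + m + 1"
  have "fps_nth (inner_fock (one.cr (int m) g) U) N
      = (\<Sum>B\<in>window ?M. one.cr (int m) g B * fps_nth (U B) N)"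
    by (rule inner_fock_U_nth) simp
  also have "\<dots> = (\<Sum>B\<in>window ?M. g B * one.an (int m) (\<lambda>B. fps_nth (U B) N) B)"
    by (rule sum_cr_window) auto
  also have "\<dots> = (\<Sum>B\<in>window ?M. \<Sum>k<N - m.
      A m k * (g B * one.an (- int k - 1) (\<lambda>B. fps_nth (U B) (N - m - k - 1)) B))"
    unfolding an_nth[symmetric] an_U_nth by (simp add: sum_distrib_left an_nth mult.left_commute)
  also have "\<dots> = (\<Sum>k<N - m. \<Sum>B\<in>window ?M.
      A m k * (g B * one.an (- int k - 1) (\<lambda>B. fps_nth (U B) (N - m - k - 1)) B))"
    by (rule sum.swap)
  also have "\<dots> = (\<Sum>k<N - m. A m k * fps_nth (inner_fock (one.cr (- int k - 1) g) U) (N - m - k - 1))"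
    unfolding sum_distrib_left[symmetric]
  proof (intro sum.cong refl arg_cong2[where f = "(*)"])
    fix k assume "k \<in> {..<N - m}"
    then have k: "- int ?M \<le> - int k - 1" "- int k - 1 < int ?M" "N - m - k - 1 \<le> ?M" by auto
    show "(\<Sum>B\<in>window ?M. g B * one.an (- int k - 1) (\<lambda>B. fps_nth (U B) (N - m - k - 1)) B)
        = fps_nth (inner_fock (one.cr (- int k - 1) g) U) (N - m - k - 1)"
      unfolding inner_fock_U_nth[OF k(3)] by (rule sum_cr_window[OF k(1,2), symmetric])
  qed
  finally show ?thesis .
qed

section \<open>The Q-adically contracting fixed point equation\<close>

text \<open>
  This is \<open>T a u n = (\<Sum>m. a m n * (\<Sum>k. Q ^ (m + k + 1) * A m k * u k))\<close>, written coefficient by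
  coefficient because the sums are infinite.
\<close>

definition T :: "(nat \<Rightarrow> nat \<Rightarrow> 'k) \<Rightarrow> (nat \<Rightarrow> 'k fps) \<Rightarrow> nat \<Rightarrow> 'k fps" where
  "T a u n = Abs_fps (\<lambda>N. \<Sum>m<N. a m n * (\<Sum>k<N - m. A m k * fps_nth (u k) (N - m - k - 1)))"

lemma T_nth:
  "fps_nth (T a u n) N = (\<Sum>m<N. a m n * (\<Sum>k<N - m. A m k * fps_nth (u k) (N - m - k - 1)))"
  by (simp add: T_def)

lemma T_diff: "T a (\<lambda>k. u k - w k) n = T a u n - T a w n"
  by (rule fps_ext) (simp add: T_nth right_diff_distrib sum_subtractf)

lemma T_sum: "T a (\<lambda>k. \<Sum>i\<in>I. F i k) n = (\<Sum>i\<in>I. T a (F i) n)"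
  by (rule fps_ext, simp add: T_nth fps_sum_nth sum_distrib_left)
    (simp add: sum.swap[of _ I])

text \<open>Linearity over power series is needed because the solution is a combination of vectors
  with coefficients in K[[Q]].\<close>

lemma T_mult: "T a (\<lambda>k. u k * f) n = T a u n * f"
proof (rule fps_ext)
  fix N
  \<comment> \<open>Up to the power \<open>N\<close> only indices below \<open>N\<close> matter, so
    \<open>T\<close> may be replaced by a finite sum, which visibly commutes with multiplication by
    \<open>f\<close>.\<close>
  define S where "S w = (\<Sum>m<N. \<Sum>k<N. fps_X ^ (m + k + 1) * (fps_const (a m n * A m k) * w k))"
    for w :: "nat \<Rightarrow> 'k fps"
  have S: "fps_nth (S w) i = fps_nth (T a w n) i" if i: "i \<le> N" for w i
  proof -
    have "fps_nth (S w) i = (\<Sum>m<N. \<Sum>k<N.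
        if m + k + 1 \<le> i then a m n * A m k * fps_nth (w k) (i - m - k - 1) else 0)"
      by (auto simp: S_def fps_sum_nth fps_X_power_mult_nth simp del: power_Suc intro!: sum.cong)
    also have "\<dots> = (\<Sum>m<N. \<Sum>k<i - m. a m n * A m k * fps_nth (w k) (i - m - k - 1))"
      by (intro sum.cong refl sum.mono_neutral_cong_right) (use i in auto)
    also have "\<dots> = (\<Sum>m<i. \<Sum>k<i - m. a m n * A m k * fps_nth (w k) (i - m - k - 1))"
      by (rule sum.mono_neutral_right) (use i in auto)
    finally show ?thesis by (simp add: T_nth sum_distrib_left mult.assoc)
  qed
  have "fps_nth (T a (\<lambda>k. u k * f) n) N = fps_nth (S (\<lambda>k. u k * f)) N"
    by (simp add: S)
  also have "S (\<lambda>k. u k * f) = S u * f"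
    by (simp add: S_def sum_distrib_right mult.assoc)
  also have "fps_nth (S u * f) N = fps_nth (T a u n * f) N"
    by (simp add: fps_mult_nth S)
  finally show "fps_nth (T a (\<lambda>k. u k * f) n) N = fps_nth (T a u n * f) N" .
qed

text \<open>The coefficient at \<open>N\<close> of \<open>T a d\<close> involves only coefficients
  of \<open>d\<close> below \<open>N\<close>, so all coefficients vanish by strong
  induction.\<close>

lemma T_unique:
  assumes "\<And>n. d n = - T a d n"
  shows "d n = 0"
proof -
  have "fps_nth (d n) N = 0" for n N
  proof (induction N arbitrary: n rule: less_induct)
    case (less N)
    have "fps_nth (d n) N = - fps_nth (T a d n) N" by (subst assms) simp
    also have "fps_nth (T a d n) N = 0" by (auto simp: T_nth less intro!: sum.neutral)
    finally show ?case by simp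
  qed
  then show ?thesis by (auto intro: fps_ext)
qed

end

text \<open>The equation \<open>u n = y n - T A a u n\<close> is solved power by power: this is the
  coefficient at \<open>N\<close> of \<open>u n\<close>, and the recursion descends because
  \<open>N - m - k - 1 < N\<close>.\<close>

function fix_coeff ::
  "(nat \<Rightarrow> nat \<Rightarrow> 'k) \<Rightarrow> (nat \<Rightarrow> nat \<Rightarrow> 'k) \<Rightarrow> (nat \<Rightarrow> 'k fps) \<Rightarrow> nat \<Rightarrow> nat \<Rightarrow> 'k::comm_rat_algebra_1"
where
  "fix_coeff A a y N n =
     fps_nth (y n) N - (\<Sum>m<N. a m n * (\<Sum>k<N - m. A m k * fix_coeff A a y (N - m - k - 1) k))"
  by pat_completeness auto
termination
  by (relation "measure (\<lambda>(A, a, y, N, n). N)") auto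

declare fix_coeff.simps [simp del]

lemma T_fixed_point: "\<exists>u. \<forall>n. u n = y n - T A a u n"
proof (intro exI allI fps_ext)
  fix n N
  show "fps_nth (Abs_fps (\<lambda>N. fix_coeff A a y N n)) N
      = fps_nth (y n - T A a (\<lambda>n. Abs_fps (\<lambda>N. fix_coeff A a y N n)) n) N"
    by (simp add: T_nth fix_coeff.simps[of A a y N n])
qed

section \<open>Equations for the partial inner product\<close>

context
  fixes A :: "nat \<Rightarrow> nat \<Rightarrow> 'k::comm_rat_algebra_1"
    and AA :: "nat \<Rightarrow> nat \<Rightarrow> nat \<Rightarrow> nat \<Rightarrow> 'k"
begin

text \<open>The unnormalised partial inner product, before division by its vacuum
  coefficient.\<close>

definition V :: "adm \<Rightarrow> 'k fps" where
  "V = inner_snd (bogoliubov12 AA) (U A)"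

definition W :: "adm \<times> adm \<Rightarrow> 'k" where
  "W = bogoliubov12 AA"

text \<open>
  In terms of the operators of one component, \<open>hat B n\<close> includes the Koszul sign of \<open>B\<close>.
\<close>

definition hat :: "adm \<Rightarrow> nat \<Rightarrow> 'k fps" where
  "hat B n = inner_fock (\<lambda>C. two.cr (Inr (- int n - 1)) W (B, C)) (U A)"

lemma W_cr:
  assumes "x \<notin> {0..} <+> {0..}"
  shows "two.cr x W (B, C) = - ((\<Sum>p\<in>one.parts B. AA 1 (component x) (label p) (label2 x) * two.cr (Inl p) W (B, C))
      + (\<Sum>p\<in>one.parts C. AA 2 (component x) (label p) (label2 x) * two.cr (Inr p) W (B, C)))"
  unfolding W_def bogoliubov12_eq two.cr_bog[OF assms] two_parts
  by (simp add: sum.Plus component_def label2_def)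

lemma cr_V_nth:
  assumes "N \<le> M"
  shows "fps_nth (one.cr r V B) N = (\<Sum>C\<in>window M. two.cr (Inl r) W (B, C) * fps_nth (U A C) N)"
  by (simp add: one.cr_def V_def inner_snd_def two_cr_Inl sgn1_mult_nth W_def[symmetric]
      inner_fock_U_nth[OF assms] sum_distrib_left mult.assoc)

text \<open>An operator on the first component commutes with the pairing over the second.\<close>

lemma cr_V_eq: "one.cr r V B = inner_fock (\<lambda>C. two.cr (Inl r) W (B, C)) (U A)"
  by (rule fps_ext) (simp add: cr_V_nth[OF order_refl] inner_fock_U_nth[OF order_refl])

lemma two_cr_Inr_one: "two.cr (Inr r) v (B, C) = koszul B * one.cr r (\<lambda>C. v (B, C)) C"
  by (simp add: two_cr_Inr one.cr_def mult.assoc)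

lemma inner_fock_scale:
  "fps_nth (inner_fock (\<lambda>C. a * g C) (U A)) N = a * fps_nth (inner_fock g (U A)) N"
  by (simp add: inner_fock_U_nth[OF order_refl] sum_distrib_left mult.assoc)

text \<open>The Koszul sign depends only on \<open>B\<close>, so it factors out of the pairing and
  is the same on both sides of \<open>inner_fock_cr_U_nth\<close>.\<close>

lemma inner_fock_cr_Inr_nth:
  "fps_nth (inner_fock (\<lambda>C. two.cr (Inr (int m)) W (B, C)) (U A)) N
     = (\<Sum>k<N - m. A m k * fps_nth (hat B k) (N - m - k - 1))"
  unfolding hat_def two_cr_Inr_one inner_fock_scale inner_fock_cr_U_nth
  by (simp add: sum_distrib_left mult.left_commute)

text \<open>The annihilation equation \<open>W_cr\<close> is paired with \<open>U A\<close>; its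
  second-component terms become \<open>T\<close> applied to \<open>hat B\<close>.\<close>

lemma inner_fock_W_cr:
  assumes x: "x \<notin> {0..} <+> {0..}"
  shows "inner_fock (\<lambda>C. two.cr x W (B, C)) (U A)
      = - (\<Sum>p\<in>one.parts B. fps_const (AA 1 (component x) (label p) (label2 x)) * one.cr p V B)
        - T A (\<lambda>m n. AA 2 (component x) m n) (hat B) (label2 x)"
proof (rule fps_ext)
  fix N
  let ?i = "component x" and ?n = "label2 x"
  \<comment> \<open>Particles of a state in \<open>window N\<close> lie below \<open>N\<close> and
    empty modes contribute zero, so the index set can be made independent of
    \<open>C\<close>.\<close>
  have parts: "(\<Sum>p\<in>one.parts C. AA 2 ?i (label p) ?n * two.cr (Inr p) W (B, C))
      = (\<Sum>m<N. AA 2 ?i m ?n * two.cr (Inr (int m)) W (B, C))" if C: "C \<in> window N" for C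
  proof -
    have "(\<Sum>m<N. AA 2 ?i m ?n * two.cr (Inr (int m)) W (B, C))
        = (\<Sum>p\<in>int ` {..<N}. AA 2 ?i (label p) ?n * two.cr (Inr p) W (B, C))"
      by (subst sum.reindex) auto
    also have "\<dots> = (\<Sum>p\<in>one.parts C. AA 2 ?i (label p) ?n * two.cr (Inr p) W (B, C))"
    proof (rule sum.mono_neutral_right)
      have "p = int (nat p) \<and> nat p < N" if "p \<in> one.parts C" for p
        using that C by (auto simp: one_parts window_def)
      then show "one.parts C \<subseteq> int ` {..<N}" by blast
    qed (auto simp: one_parts two_cr_Inr)
    finally show ?thesis by simp
  qed
  have "fps_nth (inner_fock (\<lambda>C. two.cr x W (B, C)) (U A)) N
      = (\<Sum>C\<in>window N. two.cr x W (B, C) * fps_nth (U A C) N)"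
    by (simp add: inner_fock_U_nth)
  also have "\<dots> = (\<Sum>C\<in>window N.
      - (\<Sum>p\<in>one.parts B. AA 1 ?i (label p) ?n * (two.cr (Inl p) W (B, C) * fps_nth (U A C) N))
      - (\<Sum>m<N. AA 2 ?i m ?n * (two.cr (Inr (int m)) W (B, C) * fps_nth (U A C) N)))"
    by (intro sum.cong refl, subst W_cr[OF x])
      (simp add: parts algebra_simps sum_distrib_left)
  also have "\<dots> = - (\<Sum>p\<in>one.parts B. AA 1 ?i (label p) ?n * fps_nth (one.cr p V B) N)
      - (\<Sum>m<N. AA 2 ?i m ?n * fps_nth (inner_fock (\<lambda>C. two.cr (Inr (int m)) W (B, C)) (U A)) N)"
    by (simp add: sum_subtractf sum_negf cr_V_nth[OF order_refl] inner_fock_U_nth[OF order_refl]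
        sum_distrib_left sum.swap[of _ "window N"])
  also have "\<dots> = fps_nth (- (\<Sum>p\<in>one.parts B. fps_const (AA 1 ?i (label p) ?n) * one.cr p V B)
      - T A (\<lambda>m n. AA 2 ?i m n) (hat B) ?n) N"
    by (simp add: fps_sum_nth T_nth inner_fock_cr_Inr_nth)
  finally show "fps_nth (inner_fock (\<lambda>C. two.cr x W (B, C)) (U A)) N = \<dots>" .
qed

text \<open>\<open>hat B\<close> solves a fixed point equation whose inhomogeneous part is a
  combination of the \<open>one.cr p V B\<close>. Solving it and substituting into the
  first-component equations eliminates \<open>hat B\<close>.\<close>

lemma V_cr_ex:
  "\<exists>R. \<forall>n B. one.cr (- int n - 1) V B = - (\<Sum>p\<in>one.parts B. R (label p) n * one.cr p V B)"
proof -
  \<comment> \<open>The equation is solved for each source index \<open>m\<close> separately, so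
    \<open>C\<close> does not depend on \<open>B\<close>.\<close>
  have "\<forall>m. \<exists>u. \<forall>n. u n = - fps_const (AA 1 2 m n) - T A (AA 2 2) u n"
    by (rule allI, rule T_fixed_point)
  then obtain C where C: "\<And>m n. C m n = - fps_const (AA 1 2 m n) - T A (AA 2 2) (C m) n"
    by metis
  have hat: "hat B n = - (\<Sum>p\<in>one.parts B. fps_const (AA 1 2 (label p) n) * one.cr p V B)
      - T A (AA 2 2) (hat B) n" for B n
    using inner_fock_W_cr[of "Inr (- int n - 1)" B]
    by (simp add: component_def label2_def hat_def)
  have T_C: "T A a (\<lambda>n. \<Sum>p\<in>one.parts B. C (label p) n * one.cr p V B) n
      = (\<Sum>p\<in>one.parts B. T A a (C (label p)) n * one.cr p V B)" for a B n
    by (simp add: T_sum T_mult)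
  have hat_C: "hat B n = (\<Sum>p\<in>one.parts B. C (label p) n * one.cr p V B)" for B n
  proof -
    \<comment> \<open>The difference satisfies the homogeneous equation, whose only solution is
      zero.\<close>
    let ?d = "\<lambda>n. hat B n - (\<Sum>p\<in>one.parts B. C (label p) n * one.cr p V B)"
    have "?d n = - T A (AA 2 2) ?d n" for n
      unfolding T_diff T_C
      by (subst hat, subst C)
        (simp add: algebra_simps sum_subtractf sum_negf sum.distrib del: fps_const_neg)
    from T_unique[of ?d, OF this] show ?thesis by simp
  qed
  \<comment> \<open>The direct first-component term plus the detour through the second component,
    with \<open>hat B\<close> replaced by its solution.\<close>
  define R where "R m n = fps_const (AA 1 1 m n) + T A (AA 2 1) (C m) n" for m n
  have "one.cr (- int n - 1) V B = - (\<Sum>p\<in>one.parts B. R (label p) n * one.cr p V B)" for n B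
  proof -
    have "hat B = (\<lambda>n. \<Sum>p\<in>one.parts B. C (label p) n * one.cr p V B)"
      using hat_C by auto
    then show ?thesis
      using inner_fock_W_cr[of "Inl (- int n - 1)" B]
      by (simp add: component_def label2_def cr_V_eq[symmetric] T_C R_def distrib_right
          sum.distrib)
  qed
  then show ?thesis by blast
qed

section \<open>Charge, normalisation and conclusion\<close>

lemma W_balanced:
  assumes "W (B, C) \<noteq> 0"
  shows "card (one.parts B) + card (one.parts C) = card (one.holes B) + card (one.holes C)"
  using two.bog_balanced[of _ "(B, C)"] assms
  by (simp add: W_def bogoliubov12_eq two_parts two_holes card_Plus one.finite_parts one.finite_holes)

text \<open>Both paired vectors have charge zero, hence so does every contributing \<open>B\<close>;
  without holes it then has no particles.\<close>

lemma V_no_holes: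
  assumes "one.holes B = {}" "one.parts B \<noteq> {}"
  shows "V B = 0"
proof -
  have "W (B, C) * fps_nth (U A C) N = 0" for C N
  proof (rule ccontr)
    assume *: "W (B, C) * fps_nth (U A C) N \<noteq> 0"
    then have "U A C \<noteq> 0" by auto
    then have "card (one.parts C) = card (one.holes C)"
      by (simp add: U_def bogoliubov_eq one.bog_balanced)
    moreover have "W (B, C) \<noteq> 0" using * by auto
    ultimately have "card (one.parts B) = 0" using W_balanced[of B C] assms by simp
    then show False using assms by (simp add: one.finite_parts)
  qed
  then show ?thesis
    by (intro fps_ext)
      (simp add: V_def inner_snd_def W_def[symmetric] inner_fock_U_nth[OF order_refl])
qed

text \<open>Over the vacuum of the first component there are no first-component particles and the
  Koszul sign is \<open>1\<close>, so the equations of \<open>W\<close> reduce to those of the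
  one-component transform, which determine it.\<close>

lemma W_vac: "W (vac, C) = bogoliubov (AA 2 2) C"
  unfolding bogoliubov_eq
proof (rule one.eq_by_holes[where c = "\<lambda>p h. AA 2 2 (label p) (label h)"])
  fix h B assume h: "h \<notin> {0..}" "h \<in> modes B"
  have k: "koszul vac = (1 :: 'k)" by (simp add: koszul_def charge_def)
  have "one.parts vac = {}" by (auto simp: one_parts)
  then  show "one.cr h (\<lambda>C. W (vac, C)) B
      = - (\<Sum>p\<in>one.parts B. AA 2 2 (label p) (label h) * one.cr p (\<lambda>C. W (vac, C)) B)"
    using W_cr[of "Inr h" vac B] h
    by (simp add: two_cr_Inr_one k component_def label2_def)
next
  fix B assume "one.holes B = {}" "one.parts B \<noteq> {}"
  moreover have "one.parts vac = {}" "one.holes vac = {}" by (auto simp: one_parts one_holes)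
  ultimately show "W (vac, B) = 0"
    using W_balanced[of vac B] one.finite_parts[of B] by (metis add_0 card.empty card_0_eq)
next
  fix B assume "one.holes B = {}" "one.parts B \<noteq> {}"
  then show "one.bog (\<lambda>p h. AA 2 2 (label p) (label h)) B = 0"
    using one.bog_balanced[of _ B] one.finite_parts[of B] by (metis card.empty card_0_eq)
qed (auto simp: one.cr_bog W_def bogoliubov12_eq two.bog_vac one.bog_vac)

lemma V_vac: "V vac = inner_fock (bogoliubov (AA 2 2)) (U A)"
  by (simp add: V_def inner_snd_def W_def[symmetric] W_vac)

text \<open>Multiplication by a power series preserves the annihilation equations and the vanishing
  at nonvacuum states without holes. Normalising the vacuum coefficient to \<open>1\<close> then
  lets \<open>eq_by_holes\<close> identify the vector.\<close>

lemma V_normalized_ex: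
  "\<exists>R. (\<lambda>B. V B * fps_right_inverse (V vac) 1) = bogoliubov R"
proof -
  let ?i = "fps_right_inverse (V vac) 1"
  obtain R where R: "\<And>n B. one.cr (- int n - 1) V B
      = - (\<Sum>p\<in>one.parts B. R (label p) n * one.cr p V B)"
    using V_cr_ex by blast
  \<comment> \<open>The vacuum coefficient is the normalising series, whose constant term is
    \<open>1\<close>.\<close>
  have inv: "V vac * ?i = 1"
    by (rule fps_right_inverse) (simp only: V_vac U_def inner_fock_bogoliubov_nth_0 mult_1)
  have "V B * ?i = bogoliubov R B" for B
    unfolding bogoliubov_eq
  proof (rule one.eq_by_holes[where c = "\<lambda>p h. R (label p) (label h)"])
    fix h B assume h: "h \<notin> {0..}" "h \<in> modes B"
    have scale: "one.cr r (\<lambda>B. V B * ?i) B = one.cr r V B * ?i" for r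
      by (simp add: one.cr_def mult.assoc)
    show "one.cr h (\<lambda>B. V B * ?i) B
        = - (\<Sum>p\<in>one.parts B. R (label p) (label h) * one.cr p (\<lambda>B. V B * ?i) B)"
      using R[of "label h" B] h by (simp add: scale hole_label sum_distrib_right mult.assoc)
  next
    fix B assume "one.holes B = {}" "one.parts B \<noteq> {}"
    then show "one.bog (\<lambda>p h. R (label p) (label h)) B = 0"
      using one.bog_balanced[of _ B] one.finite_parts[of B] by (metis card.empty card_0_eq)
  qed (auto simp: one.cr_bog V_no_holes inv one.bog_vac)
  then show ?thesis by blast
qed

end

theorem theorem4p1:
  fixes AA :: "nat \<Rightarrow> nat \<Rightarrow> nat \<Rightarrow> nat \<Rightarrow> 'k::comm_rat_algebra_1"
    and A :: "nat \<Rightarrow> nat \<Rightarrow> 'k"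
  shows
    "let V\<^sub>1 = bogoliubov12 AA;
         V\<^sub>2 = bogoliubov (\<lambda>m n. fps_X ^ (m + n + 1) * fps_const (A m n));
         V\<^sub>0 = inner_fock (bogoliubov (AA 2 2)) V\<^sub>2;
         V' = inner_snd V\<^sub>1 V\<^sub>2;
         V = (\<lambda>B. V' B * fps_right_inverse V\<^sub>0 1)
     in \<exists>R :: nat \<Rightarrow> nat \<Rightarrow> 'k fps. V = bogoliubov R"
  using V_normalized_ex[of A AA] unfolding Let_def V_vac by (simp add: V_def U_def)

end
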